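(* Let $F$ be a topological field that is complete (with respect to its additive group uniformity) and satisfies the Stone-Weierstrass theorem. An $F$-algebra $A$ is (isomorphic, as an $F$-algebra, to) the algebra $C(X,F)$ of $F$-valued continuous functions over a compact $F$-Tychonoff space $X$ if and only if: (i) $A$ is Gelfand; (ii) $A$ is semisimple; (iii) the spectrum $\sigma(a)$ of every $a\in A$ is compact; (iv) every prime ideal of $A$ is contained in a unique maximal ideal; (v) $A$ is complete with respect to its canonical uniformity.
   Context: Topological fields have continuous addition, multiplication and inversion and are proper (not indiscrete), hence Hausdorff. $F$-algebras are commutative and unital. A space $X$ is $F$-Tychonoff if it is $T_1$ and for every closed $C\subset X$ and $x\in X\setminus C$ there is a continuous $f:X\to F$ with $f(x)=1$ and $f|_C=0$. $C(X,F)$ is the $F$-algebra of continuous functions $X\to F$. $\mathrm{Max}(A)$ is the set of maximal ideals of $A$. $A$ is Gelfand if for every $M\in\mathrm{Max}(A)$ the canonical map $F\to A/M$ is an isomorphism (so $a+M$ is regarded as an element of $F$). $A$ is semisimple if $\bigcap_{M\in\mathrm{Max}(A)}M=\{0\}$. The spectrum is $\sigma(a)=\{\lambda\in F: a-\lambda\cdot1\text{ is not invertible}\}$. The canonical uniformity on a Gelfand algebra $A$ has basic entourages $V_U=\{(a,b)\in A\times A:(b-a)+M\in U\ \forall M\in\mathrm{Max}(A)\}=\{(a,b):\sigma(b-a)\subset U\}$, with $U$ ranging over a base of symmetric open neighborhoods of $0$ in $F$. A topological field $F$ different from $\mathbb{C}$ is said to satisfy the Stone-Weierstrass theorem if for every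 compact Hausdorff space $X$, every $F$-subalgebra of $C(X,F)$ that contains the constant functions and separates points is dense in $C(X,F)$ for the topology of the canonical uniformity (equivalently, of uniform convergence). In the case $F=\mathbb{C}$ the subalgebra is additionally required to be closed under complex conjugation; in this sense both $\mathbb{R}$ and $\mathbb{C}$ satisfy the Stone-Weierstrass theorem.
   Formalization: For F = ℂ only, a further condition is added to (i)–(v): the functions M ↦ a+M on Max(A) are closed under complex conjugation. Without it the "if" part fails, e.g. for McKissick's nontrivial normal uniform algebra R(K). For other F the statement is unchanged. *)

theory Defs
  imports "HOL-Analysis.Analysis" "HOL-Algebra.QuotRing" "HOL-Algebra.Subrings" "HOL-Algebra.Module"
begin

section \<open>Topological fields\<close>

text \<open>
  The axioms of \<^class>\<open>uniform_topological_group_add\<close> force the uniformity to be the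
  additive group uniformity of the topology, so the class adds no data to a topological field,
  and \<^term>\<open>complete UNIV\<close> is completeness with respect to that uniformity.
\<close>

class topological_field =
  field + uniform_topological_group_add + topological_ab_group_add + topological_semigroup_mult +
  assumes tendsto_inverse_nhds: "a \<noteq> 0 \<Longrightarrow> filterlim inverse (nhds (inverse a)) (nhds a)"
    and not_indiscrete: "\<exists>U. open U \<and> U \<noteq> {} \<and> U \<noteq> UNIV"

lemma uniformity_topological_field:
  "(uniformity :: ('f::topological_field \<times> 'f) filter) = filtercomap (\<lambda>(x, y). y - x) (nhds 0)"
proof (rule filter_eqI)
  fix P :: "'f \<times> 'f \<Rightarrow> bool"
  show "eventually P uniformity \<longleftrightarrow> eventually P (filtercomap (\<lambda>(x, y). y - x) (nhds 0))"
  proof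
    assume "eventually P uniformity"
    then obtain D where D: "eventually D uniformity" "\<And>a b c. D (a, b) \<Longrightarrow> P (a + c, b + c)"
      using uniformity_of_uniform_continuous_invariant[OF uniformly_continuous_add'] by metis
    have "eventually (\<lambda>(x', y). x' = 0 \<longrightarrow> D (0, y)) uniformity"
      using D(1) by eventually_elim auto
    hence "eventually (\<lambda>t. D (0, t)) (nhds 0)"
      by (simp add: eventually_nhds_uniformity)
    moreover have "P (a, b)" if "D (0, b - a)" for a b
      using D(2)[OF that, of a] by simp
    ultimately show "eventually P (filtercomap (\<lambda>(x, y). y - x) (nhds 0))"
      unfolding eventually_filtercomap by (intro exI[of _ "\<lambda>t. D (0, t)"]) auto
  next
    assume "eventually P (filtercomap (\<lambda>(x, y). y - x) (nhds 0))"
    then obtain Q where Q: "eventually Q (nhds (0::'f))" "\<And>x y. Q (y - x) \<Longrightarrow> P (x, y)"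
      unfolding eventually_filtercomap by auto
    have "eventually (\<lambda>(x', y). x' = 0 \<longrightarrow> Q y) (uniformity :: ('f \<times> 'f) filter)"
      using Q(1) by (simp add: eventually_nhds_uniformity)
    then obtain D where D: "eventually D uniformity"
      "\<And>a b c. D (a, b) \<Longrightarrow> (\<lambda>(x', y). x' = 0 \<longrightarrow> Q y) (a - c, b - c)"
      using uniformity_of_uniform_continuous_invariant[OF uniformly_continuous_minus'] by metis
    show "eventually P uniformity"
      using D(1)
    proof eventually_elim
      case (elim z)
      obtain x y where z: "z = (x, y)" by (cases z)
      have "Q (y - x)" using D(2)[of x y x] elim z by simp
      thus ?case using Q(2) z by simp
    qed
  qed
qed

instance topological_field \<subseteq> t2_space
proof
  fix a b :: 'a
  assume ab: "a \<noteq> b"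
  define d where "d = a - b"
  have d: "d \<noteq> 0" using ab by (simp add: d_def)
  obtain U and x y :: 'a where U: "open U" "x \<in> U" "y \<notin> U"
    using not_indiscrete[where 'a='a] by blast
  define g where "g = (\<lambda>t. y + ((x - y) * inverse d) * t)"
  have cg: "continuous_on UNIV g"
    unfolding g_def continuous_on_def by (intro ballI tendsto_intros)
  define V where "V = g -` U"
  have V: "open V" "d \<in> V" "0 \<notin> V"
    using open_vimage[OF U(1) cg] U d by (auto simp: V_def g_def mult.assoc)
  have "continuous_on UNIV (\<lambda>p::'a\<times>'a. fst p - snd p)"
    unfolding continuous_on_def by (intro ballI tendsto_intros)
  hence "open ((\<lambda>p. fst p - snd p) -` V)"
    by (rule open_vimage[OF V(1)])
  moreover have "(a, b) \<in> (\<lambda>p. fst p - snd p) -` V"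
    using V(2) by (simp add: d_def)
  ultimately obtain P Q where PQ: "open P" "open Q" "(a, b) \<in> P \<times> Q"
    "P \<times> Q \<subseteq> (\<lambda>p. fst p - snd p) -` V"
    by (rule open_prod_elim)
  have "P \<inter> Q = {}"
  proof (rule ccontr)
    assume "P \<inter> Q \<noteq> {}"
    then obtain t where "(t, t) \<in> P \<times> Q" by auto
    hence "0 \<in> V" using PQ(4) by fastforce
    thus False using V(3) by simp
  qed
  thus "\<exists>U V. open U \<and> open V \<and> a \<in> U \<and> b \<in> V \<and> U \<inter> V = {}"
    using PQ by blast
qed

text \<open>
  \<open>complex_identification \<phi>\<close>: \<open>\<phi>\<close> is an isomorphism of topological fields onto the complex
  numbers.  The field ``is \<open>\<complex>\<close>'' iff some \<open>\<phi>\<close> exists.  The only continuous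
  automorphisms of \<open>\<complex>\<close> are the identity and conjugation, so \<open>conj_along \<phi>\<close> does not depend
  on \<open>\<phi>\<close>.
\<close>

definition complex_identification :: "('f::topological_field \<Rightarrow> complex) \<Rightarrow> bool" where
  "complex_identification \<phi> \<longleftrightarrow>
     bij \<phi> \<and> (\<forall>x y. \<phi> (x + y) = \<phi> x + \<phi> y) \<and> (\<forall>x y. \<phi> (x * y) = \<phi> x * \<phi> y) \<and>
     continuous_on UNIV \<phi> \<and> continuous_on UNIV (inv_into UNIV \<phi>)"

definition conj_along :: "('f \<Rightarrow> complex) \<Rightarrow> 'f \<Rightarrow> 'f" where
  "conj_along \<phi> c = inv_into UNIV \<phi> (cnj (\<phi> c))"


section \<open>Algebras\<close>

definition field_ring :: "'f::field ring" where
  "field_ring = \<lparr>carrier = UNIV, mult = (*), one = 1, zero = 0, add = (+)\<rparr>"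

definition algebra_iso ::
  "('f, 'a, 'm) module_scheme \<Rightarrow> ('f, 'b, 'n) module_scheme \<Rightarrow> ('a \<Rightarrow> 'b) set" where
  "algebra_iso A B =
     {h \<in> ring_iso A B. \<forall>c. \<forall>a\<in>carrier A. h (c \<odot>\<^bsub>A\<^esub> a) = c \<odot>\<^bsub>B\<^esub> h a}"

text \<open>Functions on \<open>X\<close> are represented as elements of \<^term>\<open>extensional (topspace X)\<close>.\<close>

definition cfun_algebra :: "'x topology \<Rightarrow> ('f::topological_field, 'x \<Rightarrow> 'f) module" where
  "cfun_algebra X =
     \<lparr>carrier = {f \<in> extensional (topspace X). continuous_map X euclidean f},
      mult = (\<lambda>f g. \<lambda>x\<in>topspace X. f x * g x),
      one = (\<lambda>x\<in>topspace X. 1),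
      zero = (\<lambda>x\<in>topspace X. 0),
      add = (\<lambda>f g. \<lambda>x\<in>topspace X. f x + g x),
      smult = (\<lambda>c f. \<lambda>x\<in>topspace X. c * f x)\<rparr>"

lemma cfun_algebra_is_algebra:
  "Module.algebra field_ring (cfun_algebra X :: ('f::topological_field, 'x \<Rightarrow> 'f) module)"
proof -
  let ?C = "cfun_algebra X :: ('f, 'x \<Rightarrow> 'f) module"
  have bin: "continuous_map X euclidean (\<lambda>x. h (b x) (c x))"
    if "continuous_map X euclidean b" "continuous_map X euclidean c"
      "continuous_on UNIV (\<lambda>p. h (fst p) (snd p))"
    for b c :: "'x \<Rightarrow> 'f" and h :: "'f \<Rightarrow> 'f \<Rightarrow> 'f"
  proof -
    have p: "continuous_map X euclidean (\<lambda>x. (b x, c x))"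
      using continuous_map_pairedI[OF that(1,2)] unfolding prod_topology_euclidean .
    have "continuous_map euclidean euclidean (\<lambda>p. h (fst p) (snd p))"
      unfolding continuous_map_iff_continuous2 by (rule that(3))
    from continuous_map_compose[OF p this] show ?thesis
      unfolding o_def fst_conv snd_conv .
  qed
  have addc: "continuous_map X euclidean (\<lambda>x. b x + c x)"
    and mulc: "continuous_map X euclidean (\<lambda>x. b x * c x)"
    if "continuous_map X euclidean b" "continuous_map X euclidean c" for b c :: "'x \<Rightarrow> 'f"
  proof -
    have c: "continuous_on UNIV (\<lambda>p::'f\<times>'f. fst p + snd p)"
      "continuous_on UNIV (\<lambda>p::'f\<times>'f. fst p * snd p)"
      unfolding continuous_on_def by (intro ballI tendsto_intros)+
    show "continuous_map X euclidean (\<lambda>x. b x + c x)" by (rule bin[OF that c(1)])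
    show "continuous_map X euclidean (\<lambda>x. b x * c x)" by (rule bin[OF that c(2)])
  qed
  have minc: "continuous_map X euclidean (\<lambda>x. - b x)"
    if "continuous_map X euclidean b" for b :: "'x \<Rightarrow> 'f"
    using mulc[of "\<lambda>_. - 1", OF _ that] by simp
  have "cring (field_ring :: 'f ring)"
  proof (intro cringI abelian_groupI comm_monoidI)
    show "\<exists>y\<in>carrier field_ring. y \<oplus>\<^bsub>field_ring\<^esub> x = \<zero>\<^bsub>field_ring\<^esub>" for x :: 'f
      by (intro bexI[of _ "- x"]) (auto simp: field_ring_def)
  qed (auto simp: field_ring_def algebra_simps)
  moreover have "cring ?C"
  proof (intro cringI abelian_groupI comm_monoidI)
    fix b assume b: "b \<in> carrier ?C"
    show "\<exists>c\<in>carrier ?C. c \<oplus>\<^bsub>?C\<^esub> b = \<zero>\<^bsub>?C\<^esub>"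
      using b by (intro bexI[of _ "\<lambda>x\<in>topspace X. - b x"]) (auto simp: cfun_algebra_def minc fun_eq_iff)
  qed (auto simp: cfun_algebra_def fun_eq_iff extensional_def algebra_simps addc mulc)
  ultimately show ?thesis
    by (rule algebraI)
      (auto simp: cfun_algebra_def field_ring_def fun_eq_iff extensional_def algebra_simps mulc)
qed

definition F_Tychonoff :: "'f::topological_field itself \<Rightarrow> 'x topology \<Rightarrow> bool" where
  "F_Tychonoff _ X \<longleftrightarrow> t1_space X \<and>
     (\<forall>C x. closedin X C \<and> x \<in> topspace X - C \<longrightarrow>
        (\<exists>f :: 'x \<Rightarrow> 'f. continuous_map X euclidean f \<and> f x = 1 \<and> (\<forall>y\<in>C. f y = 0)))"

text \<open>
  A compact \<open>F\<close>-Tychonoff space \<open>Y\<close> of any type with \<open>A \<cong> C(Y, F)\<close> can be replaced by one whose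
  points are subsets of the carrier of \<open>A\<close>, namely the kernels of the evaluations at points of
  \<open>Y\<close>.
\<close>

theorem function_algebra_on_ideals:
  fixes A :: "('f::topological_field, 'a, 'm) module_scheme" and Y :: "'y topology"
  assumes Y: "compact_space Y" "F_Tychonoff TYPE('f) Y" and h: "h \<in> algebra_iso A (cfun_algebra Y)"
  shows "\<exists>X :: 'a set topology.
           compact_space X \<and> F_Tychonoff TYPE('f) X \<and> algebra_iso A (cfun_algebra X) \<noteq> {}"
proof -
  have ring: "h \<in> ring_iso A (cfun_algebra Y)"
    and hsm: "\<And>c a. a \<in> carrier A \<Longrightarrow> h (c \<odot>\<^bsub>A\<^esub> a) = c \<odot>\<^bsub>cfun_algebra Y\<^esub> h a"
    using h by (auto simp: algebra_iso_def)
  have surj: "h ` carrier A = carrier (cfun_algebra Y)"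
    using ring_iso_memE(5)[OF ring] by (simp add: bij_betw_def)
  define k where "k = (\<lambda>y. {a \<in> carrier A. h a y = 0})"
  have "inj_on k (topspace Y)"
  proof (rule inj_onI, rule ccontr)
    fix y z assume yz: "y \<in> topspace Y" "z \<in> topspace Y" "k y = k z" "y \<noteq> z"
    have "closedin Y {z}"
      using Y(2) yz(2) by (simp add: F_Tychonoff_def closedin_t1_singleton)
    then obtain f :: "'y \<Rightarrow> 'f" where f: "continuous_map Y euclidean f" "f y = 1" "f z = 0"
      using Y(2) yz unfolding F_Tychonoff_def by (metis Diff_iff insertI1 singletonD)
    have "restrict f (topspace Y) \<in> carrier (cfun_algebra Y)"
      using f(1) by (simp add: cfun_algebra_def)
    then obtain a where a: "a \<in> carrier A" "h a = restrict f (topspace Y)"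
      using surj by (metis imageE)
    have "a \<in> k z" "a \<notin> k y" using a f yz(1,2) by (simp_all add: k_def)
    thus False using yz(3) by simp
  qed
  define j where "j = inv_into (topspace Y) k"
  have jk: "j (k y) = y" if "y \<in> topspace Y" for y
    using that \<open>inj_on k (topspace Y)\<close> by (simp add: j_def)
  define X where "X = pullback_topology (k ` topspace Y) j Y"
  have topX: "topspace X = k ` topspace Y"
    by (auto simp: X_def topspace_pullback_topology jk)
  have cj: "continuous_map X Y j"
    using continuous_map_pullback[OF continuous_map_id, of "k ` topspace Y" j Y] by (simp add: X_def)
  have ck: "continuous_map Y X k"
    unfolding X_def
  proof (rule continuous_map_pullback')
    show "continuous_map Y Y (j \<circ> k)"
      by (rule continuous_map_eq[OF continuous_map_id]) (simp add: jk)
  qed auto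
  have kj: "k (j x) = x" and jin: "j x \<in> topspace Y" if "x \<in> topspace X" for x
    using that topX jk by auto
  have kin: "k y \<in> topspace X" if "y \<in> topspace Y" for y
    using that topX by auto
  have homeo: "Y homeomorphic_space X"
    unfolding homeomorphic_space_def homeomorphic_maps_def
    using cj ck jk kj by blast
  have "compact_space X"
    using homeomorphic_compact_space[OF homeo] Y(1) by simp
  moreover have "F_Tychonoff TYPE('f) X"
    unfolding F_Tychonoff_def
  proof (intro conjI allI impI)
    show "t1_space X"
      using homeomorphic_t1_space[OF homeo] Y(2) by (simp add: F_Tychonoff_def)
    fix C x assume Cx: "closedin X C \<and> x \<in> topspace X - C"
    have "closedin Y {y \<in> topspace Y. k y \<in> C}"
      using Cx by (intro closedin_continuous_map_preimage[OF ck]) simp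
    moreover have "j x \<in> topspace Y - {y \<in> topspace Y. k y \<in> C}"
      using Cx kj[of x] jin[of x] by simp
    ultimately obtain f :: "'y \<Rightarrow> 'f" where f: "continuous_map Y euclidean f" "f (j x) = 1"
      "\<forall>y\<in>{y \<in> topspace Y. k y \<in> C}. f y = 0"
      using Y(2) unfolding F_Tychonoff_def by blast
    have "f (j c) = 0" if "c \<in> C" for c
    proof -
      have "c \<in> topspace X" using that Cx closedin_subset by blast
      hence "j c \<in> topspace Y" "k (j c) \<in> C" using jin kj that by simp_all
      thus ?thesis using f(3) by blast
    qed
    thus "\<exists>f :: 'a set \<Rightarrow> 'f. continuous_map X euclidean f \<and> f x = 1 \<and> (\<forall>y\<in>C. f y = 0)"
      using continuous_map_compose[OF cj f(1)] f(2) by (intro exI[of _ "f \<circ> j"]) simp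
  qed
  moreover have "algebra_iso A (cfun_algebra X) \<noteq> {}"
  proof -
    define t where "t = (\<lambda>g :: 'y \<Rightarrow> 'f. \<lambda>x\<in>topspace X. g (j x))"
    define u where "u = (\<lambda>g :: 'a set \<Rightarrow> 'f. \<lambda>y\<in>topspace Y. g (k y))"
    have tin: "t g \<in> carrier (cfun_algebra X)" if "g \<in> carrier (cfun_algebra Y)" for g
      using continuous_map_compose[OF cj, of euclidean g] that
      by (simp add: t_def cfun_algebra_def o_def)
    have uin: "u g \<in> carrier (cfun_algebra Y)" if "g \<in> carrier (cfun_algebra X)" for g
      using continuous_map_compose[OF ck, of euclidean g] that
      by (simp add: u_def cfun_algebra_def o_def)
    have ut: "u (t g) = g" if "g \<in> carrier (cfun_algebra Y)" for g
      using that kin by (auto simp: u_def t_def cfun_algebra_def fun_eq_iff extensional_def jk)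
    have tu: "t (u g) = g" if "g \<in> carrier (cfun_algebra X)" for g
      using that jin by (auto simp: u_def t_def cfun_algebra_def fun_eq_iff extensional_def kj)
    have "bij_betw t (carrier (cfun_algebra Y)) (carrier (cfun_algebra X))"
      using tin uin ut tu by (intro bij_betwI[of t _ _ u]) auto
    hence "t \<in> ring_iso (cfun_algebra Y) (cfun_algebra X)"
      using jin tin
      by (intro ring_iso_memI) (auto simp: t_def cfun_algebra_def fun_eq_iff)
    hence "t \<circ> h \<in> ring_iso A (cfun_algebra X)"
      by (rule ring_iso_set_trans[OF ring])
    moreover have "t (c \<odot>\<^bsub>cfun_algebra Y\<^esub> g) = c \<odot>\<^bsub>cfun_algebra X\<^esub> t g" for c g
      using jin by (auto simp: t_def cfun_algebra_def fun_eq_iff)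
    ultimately have "t \<circ> h \<in> algebra_iso A (cfun_algebra X)"
      using hsm by (simp add: algebra_iso_def)
    thus ?thesis by blast
  qed
  ultimately show ?thesis by blast
qed

definition Max_ideals :: "('f, 'a, 'm) module_scheme \<Rightarrow> 'a set set" where
  "Max_ideals A = {M. maximalideal M A}"

definition gelfand_algebra :: "('f::field, 'a, 'm) module_scheme \<Rightarrow> bool" where
  "gelfand_algebra A \<longleftrightarrow>
     (\<forall>M\<in>Max_ideals A. (\<lambda>c. M +>\<^bsub>A\<^esub> (c \<odot>\<^bsub>A\<^esub> \<one>\<^bsub>A\<^esub>)) \<in> ring_iso field_ring (A Quot M))"

definition semisimple_algebra :: "('f, 'a, 'm) module_scheme \<Rightarrow> bool" where
  "semisimple_algebra A \<longleftrightarrow> carrier A \<inter> \<Inter>(Max_ideals A) = {\<zero>\<^bsub>A\<^esub>}"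

definition spectrum_of :: "('f, 'a, 'm) module_scheme \<Rightarrow> 'a \<Rightarrow> 'f set" where
  "spectrum_of A a = {c. a \<ominus>\<^bsub>A\<^esub> (c \<odot>\<^bsub>A\<^esub> \<one>\<^bsub>A\<^esub>) \<notin> Units A}"

text \<open>The coset \<open>a + M\<close> regarded as a scalar; meaningful for Gelfand algebras.\<close>

definition value_at :: "('f, 'a, 'm) module_scheme \<Rightarrow> 'a set \<Rightarrow> 'a \<Rightarrow> 'f" where
  "value_at A M a = (THE c. M +>\<^bsub>A\<^esub> a = M +>\<^bsub>A\<^esub> (c \<odot>\<^bsub>A\<^esub> \<one>\<^bsub>A\<^esub>))"

definition canonical_entourage :: "('f, 'a, 'm) module_scheme \<Rightarrow> 'f set \<Rightarrow> ('a \<times> 'a) set" where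
  "canonical_entourage A U =
     {(a, b) \<in> carrier A \<times> carrier A. \<forall>M\<in>Max_ideals A. value_at A M (b \<ominus>\<^bsub>A\<^esub> a) \<in> U}"

definition canonical_uniformity ::
  "('f::topological_field, 'a, 'm) module_scheme \<Rightarrow> ('a \<times> 'a) filter" where
  "canonical_uniformity A =
     (INF U\<in>{U. open U \<and> 0 \<in> U \<and> uminus ` U = U}. principal (canonical_entourage A U))"

text \<open>
  The analogue of \<^const>\<open>complete\<close> for a uniformity \<open>\<U>\<close> on a set \<open>S\<close> that is given explicitly:
  \<open>filtermap (Pair x) F \<le> \<U>\<close> says that the filter \<open>F\<close> converges to \<open>x\<close>.
\<close>

definition complete_for :: "('a \<times> 'a) filter \<Rightarrow> 'a set \<Rightarrow> bool" where
  "complete_for \<U> S \<longleftrightarrow>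
     (\<forall>F \<le> principal S. F \<noteq> bot \<longrightarrow> F \<times>\<^sub>F F \<le> \<U> \<longrightarrow> (\<exists>x\<in>S. filtermap (Pair x) F \<le> \<U>))"

text \<open>
  Vacuously true unless the field is \<open>\<complex>\<close>, when it says that the functions
  \<open>M \<mapsto> value_at A M a\<close> on the maximal ideals are closed under complex conjugation, as the
  complex Stone--Weierstrass theorem demands of a subalgebra.  Over \<open>\<complex>\<close> this does not follow
  from the other conditions characterising \<open>C(X, \<complex>)\<close>: McKissick's nontrivial normal uniform
  algebra \<open>R(K)\<close> is Gelfand, semisimple and complete, has compact spectra, and each of its prime
  ideals lies in a unique maximal ideal, but \<open>R(K) \<noteq> C(K)\<close>.
\<close>

definition conj_closed_algebra :: "('f::topological_field, 'a, 'm) module_scheme \<Rightarrow> bool" where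
  "conj_closed_algebra A \<longleftrightarrow>
     (\<forall>\<phi>. complex_identification \<phi> \<longrightarrow>
        (\<forall>a\<in>carrier A. \<exists>b\<in>carrier A. \<forall>M\<in>Max_ideals A.
            value_at A M b = conj_along \<phi> (value_at A M a)))"


section \<open>The Stone--Weierstrass property\<close>

text \<open>The condition on \<open>\<phi>\<close> is vacuous unless the field is \<open>\<complex>\<close>.\<close>

definition stone_weierstrass_on :: "'f::topological_field itself \<Rightarrow> 'x topology \<Rightarrow> bool" where
  "stone_weierstrass_on _ X \<longleftrightarrow>
     (\<forall>B :: ('x \<Rightarrow> 'f) set.
        subring B (cfun_algebra X) \<and> submodule B field_ring (cfun_algebra X) \<and>
        (\<forall>c. (\<lambda>x\<in>topspace X. c) \<in> B) \<and>
        (\<forall>x\<in>topspace X. \<forall>y\<in>topspace X. x \<noteq> y \<longrightarrow> (\<exists>f\<in>B. f x \<noteq> f y)) \<and>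
        (\<forall>\<phi> :: 'f \<Rightarrow> complex. complex_identification \<phi> \<longrightarrow>
           (\<forall>f\<in>B. (\<lambda>x\<in>topspace X. conj_along \<phi> (f x)) \<in> B))
      \<longrightarrow>
        (\<forall>f\<in>carrier (cfun_algebra X). \<forall>U. open U \<and> 0 \<in> U \<longrightarrow>
           (\<exists>g\<in>B. \<forall>x\<in>topspace X. g x - f x \<in> U)))"

text \<open>
  A definition cannot quantify over all types, so ``every compact Hausdorff space'' is rendered as
  every compact Hausdorff space with points in \<open>'f set \<times> nat \<Rightarrow> 'f\<close>.  This loses nothing:
  theorem \<open>stone_weierstrass_every_type\<close> below derives the property for spaces over any type.
\<close>

definition stone_weierstrass :: "'f::topological_field itself \<Rightarrow> bool" where
  "stone_weierstrass _ \<longleftrightarrow>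
     (\<forall>X :: ('f set \<times> nat \<Rightarrow> 'f) topology.
        compact_space X \<and> Hausdorff_space X \<longrightarrow> stone_weierstrass_on TYPE('f) X)"


theorem stone_weierstrass_every_type:
  fixes X :: "'x topology"
  assumes SW: "stone_weierstrass TYPE('f::topological_field)"
    and X: "compact_space X" "Hausdorff_space X"
  shows "stone_weierstrass_on TYPE('f) X"
  unfolding stone_weierstrass_on_def
proof (intro allI impI ballI)
  fix B :: "('x \<Rightarrow> 'f) set" and f :: "'x \<Rightarrow> 'f" and U :: "'f set"
  assume "subring B (cfun_algebra X) \<and> submodule B field_ring (cfun_algebra X) \<and>
      (\<forall>c. (\<lambda>x\<in>topspace X. c) \<in> B) \<and>
      (\<forall>x\<in>topspace X. \<forall>y\<in>topspace X. x \<noteq> y \<longrightarrow> (\<exists>f\<in>B. f x \<noteq> f y)) \<and>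
      (\<forall>\<phi> :: 'f \<Rightarrow> complex. complex_identification \<phi> \<longrightarrow>
         (\<forall>f\<in>B. (\<lambda>x\<in>topspace X. conj_along \<phi> (f x)) \<in> B))"
  hence ring: "subring B (cfun_algebra X)" and mod: "submodule B field_ring (cfun_algebra X)"
    and const: "\<And>c. (\<lambda>x\<in>topspace X. c) \<in> B"
    and sep: "\<And>x y. x \<in> topspace X \<Longrightarrow> y \<in> topspace X \<Longrightarrow> x \<noteq> y \<Longrightarrow> \<exists>f\<in>B. f x \<noteq> f y"
    and conj: "\<And>\<phi> f. complex_identification (\<phi> :: 'f \<Rightarrow> complex) \<Longrightarrow> f \<in> B \<Longrightarrow>
                 (\<lambda>x\<in>topspace X. conj_along \<phi> (f x)) \<in> B"
    by blast+
  assume f: "f \<in> carrier (cfun_algebra X)" and U: "open U \<and> 0 \<in> U"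
  have fc: "continuous_map X euclidean f" using f by (simp add: cfun_algebra_def)
  have Bsub: "B \<subseteq> carrier (cfun_algebra X)" by (rule subringE(1)[OF ring])
  have Bc: "continuous_map X euclidean b" if "b \<in> B" for b
    using Bsub that by (auto simp: cfun_algebra_def)

  let ?W = "\<lambda>b :: 'x \<Rightarrow> 'f. {p \<in> topspace (prod_topology X X). b (fst p) - b (snd p) \<in> - {0}}"
  have cdiff: "continuous_map (prod_topology X X) euclidean (\<lambda>p. b (fst p) - b (snd p))"
    if b: "continuous_map X euclidean b" for b :: "'x \<Rightarrow> 'f"
  proof -
    have c: "continuous_map euclidean euclidean (\<lambda>p::'f\<times>'f. fst p - snd p)"
      unfolding continuous_map_iff_continuous2 continuous_on_def
      by (intro ballI tendsto_intros)
    have "continuous_map (prod_topology X X) euclidean (\<lambda>p. ((b \<circ> fst) p, (b \<circ> snd) p))"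
      using continuous_map_pairedI[OF continuous_map_compose[OF continuous_map_fst b]
          continuous_map_compose[OF continuous_map_snd b]]
      unfolding prod_topology_euclidean .
    from continuous_map_compose[OF this c] show ?thesis unfolding o_def fst_conv snd_conv .
  qed
  define sepV where "sepV = (\<lambda>(V :: 'f set) (s :: nat \<Rightarrow> 'x \<Rightarrow> 'f).
     \<forall>x y. x \<in> topspace X \<longrightarrow> y \<in> topspace X \<longrightarrow> (\<forall>n. s n x = s n y) \<longrightarrow> f x - f y \<in> V)"
  have ex: "\<exists>s. (\<forall>n. s n \<in> B) \<and> (open V \<and> 0 \<in> V \<longrightarrow> sepV V s)" for V :: "'f set"
  proof (cases "open V \<and> 0 \<in> V")
    case False
    thus ?thesis using const[of 0] by (intro exI[of _ "\<lambda>_. \<lambda>x\<in>topspace X. 0"]) blast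
  next
    case True
    let ?K = "{p \<in> topspace (prod_topology X X). f (fst p) - f (snd p) \<in> - V}"
    have "closedin (prod_topology X X) ?K"
      using True by (intro closedin_continuous_map_preimage[OF cdiff[OF fc]]) (simp add: closed_Compl)
    hence K: "compactin (prod_topology X X) ?K"
      using X(1) closedin_compact_space compact_space_prod_topology by blast
    have "open (- {0 :: 'f})" by (intro open_Compl closed_singleton)
    hence op: "openin (prod_topology X X) (?W b)" if "b \<in> B" for b
      by (intro openin_continuous_map_preimage[OF cdiff[OF Bc[OF that]]]) simp
    have "?K \<subseteq> \<Union>(?W ` B)"
    proof
      fix p assume p: "p \<in> ?K"
      have "fst p \<noteq> snd p"
      proof
        assume "fst p = snd p"
        hence "f (fst p) - f (snd p) = 0" by simp
        thus False using p True by simp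
      qed
      moreover have "fst p \<in> topspace X" "snd p \<in> topspace X"
        using p by (simp_all add: mem_Times_iff)
      ultimately obtain b where b: "b \<in> B" "b (fst p) \<noteq> b (snd p)" using sep by blast
      hence "p \<in> ?W b" using p by simp
      thus "p \<in> \<Union>(?W ` B)" using b(1) by blast
    qed
    moreover have "openin (prod_topology X X) W" if "W \<in> ?W ` B" for W using op that by blast
    ultimately obtain \<F> where \<F>: "finite \<F>" "\<F> \<subseteq> ?W ` B" "?K \<subseteq> \<Union>\<F>"
      using compactinD[OF K, of "?W ` B"] by blast
    obtain S where S: "S \<subseteq> B" "finite S" "\<F> = ?W ` S"
      using finite_subset_image[OF \<F>(1,2)] by blast
    define z :: "'x \<Rightarrow> 'f" where "z = (\<lambda>x\<in>topspace X. 0)"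
    let ?S = "insert z S"
    have z: "z \<in> B" unfolding z_def by (rule const)
    have s: "range (from_nat_into ?S) = ?S"
      using S(2) by (intro range_from_nat_into countable_finite) auto
    have "from_nat_into ?S n \<in> B" for n
    proof -
      have "?S \<subseteq> B" using S(1) z by simp
      thus ?thesis by (rule subsetD) (rule from_nat_into[OF insert_not_empty])
    qed
    moreover have "sepV V (from_nat_into ?S)"
      unfolding sepV_def
    proof (intro allI impI, rule ccontr)
      fix x y
      assume xy: "x \<in> topspace X" "y \<in> topspace X"
        "\<forall>n. from_nat_into ?S n x = from_nat_into ?S n y" "f x - f y \<notin> V"
      hence "(x, y) \<in> ?K" by simp
      then obtain b where b: "b \<in> S" "(x, y) \<in> ?W b" using \<F>(3) S(3) by blast
      hence "b \<in> range (from_nat_into ?S)" unfolding s by blast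
      then obtain n where "b = from_nat_into ?S n" by blast
      hence "b x = b y" using xy(3) by blast
      thus False using b(2) by simp
    qed
    ultimately show ?thesis by blast
  qed
  define s where "s = (\<lambda>V. SOME s. (\<forall>n. s n \<in> B) \<and> (open V \<and> 0 \<in> V \<longrightarrow> sepV V s))"
  have s: "(\<forall>n. s V n \<in> B) \<and> (open V \<and> 0 \<in> V \<longrightarrow> sepV V (s V))" for V
    unfolding s_def by (rule someI_ex[OF ex])
  have sB: "s V n \<in> B" for V n using s by blast
  have sV: "f x - f y \<in> V"
    if "open V" "0 \<in> V" "x \<in> topspace X" "y \<in> topspace X" "\<forall>n. s V n x = s V n y" for V x y
  proof -
    have "sepV V (s V)" using s that(1,2) by blast
    thus ?thesis using that(3-5) unfolding sepV_def by blast
  qed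

  define \<Phi> :: "'x \<Rightarrow> 'f set \<times> nat \<Rightarrow> 'f" where "\<Phi> = (\<lambda>x (V, n). s V n x)"
  define P :: "('f set \<times> nat \<Rightarrow> 'f) topology"
    where "P = product_topology (\<lambda>_. euclidean) UNIV"
  define Y where "Y = subtopology P (\<Phi> ` topspace X)"
  have c\<Phi>P: "continuous_map X P \<Phi>"
    unfolding P_def continuous_map_componentwise_UNIV
  proof
    fix i :: "'f set \<times> nat"
    have "(\<lambda>x. \<Phi> x i) = s (fst i) (snd i)" by (simp add: \<Phi>_def case_prod_beta)
    thus "continuous_map X euclidean (\<lambda>x. \<Phi> x i)" using Bc[OF sB] by simp
  qed
  have topP: "topspace P = UNIV" by (simp add: P_def)
  have topY: "topspace Y = \<Phi> ` topspace X" by (simp add: Y_def topP)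
  have c\<Phi>: "continuous_map X Y \<Phi>"
    unfolding Y_def using c\<Phi>P by (simp add: continuous_map_in_subtopology)
  have HY: "Hausdorff_space Y"
  proof -
    have "Hausdorff_space (euclidean :: 'f topology)"
      unfolding Hausdorff_space_def disjnt_def by (simp, metis hausdorff)
    thus ?thesis
      unfolding Y_def P_def
      by (intro Hausdorff_space_subtopology) (simp add: Hausdorff_space_product_topology)
  qed
  have CY: "compact_space Y"
    using image_compactin[OF _ c\<Phi>, of "topspace X"] X(1) topY by (simp add: compact_space_def)
  have q: "quotient_map X Y \<Phi>"
    using continuous_imp_quotient_map[OF c\<Phi> X(1) HY] topY by simp
  have fib: "f x = f y" if "x \<in> topspace X" "y \<in> topspace X" "\<Phi> x = \<Phi> y" for x y
  proof (rule ccontr)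
    assume ne: "f x \<noteq> f y"
    have "s V n x = s V n y" for V n
      using fun_cong[OF that(3), of "(V, n)"] by (simp add: \<Phi>_def)
    moreover have "open (- {f x - f y})" by (intro open_Compl closed_singleton)
    moreover have "0 \<in> - {f x - f y}" using ne by simp
    ultimately have "f x - f y \<in> - {f x - f y}"
      using that(1,2) by (intro sV) simp_all
    thus False by simp
  qed
  obtain g where g: "continuous_map Y euclidean g" "\<And>x. x \<in> topspace X \<Longrightarrow> g (\<Phi> x) = f x"
    by (rule quotient_map_lift_exists[OF q fc fib]) simp_all
  define B' where "B' = {b \<in> carrier (cfun_algebra Y). (\<lambda>x\<in>topspace X. b (\<Phi> x)) \<in> B}"
  have \<Phi>in: "\<Phi> x \<in> topspace Y" if "x \<in> topspace X" for x using that topY by auto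
  interpret C: cring "cfun_algebra Y :: ('f, ('f set \<times> nat \<Rightarrow> 'f) \<Rightarrow> 'f) module"
    by (rule Module.algebra.M_cring[OF cfun_algebra_is_algebra])
  note smult_closed = module.smult_closed[OF Module.algebra.module[OF cfun_algebra_is_algebra]]
    and submoduleI = module.submoduleI[OF Module.algebra.module[OF cfun_algebra_is_algebra]]
  let ?p = "\<lambda>b :: ('f set \<times> nat \<Rightarrow> 'f) \<Rightarrow> 'f. \<lambda>x\<in>topspace X. b (\<Phi> x)"
  have pB: "?p b \<in> B" if "b \<in> B'" for b using that by (simp add: B'_def)
  have B'c: "b \<in> carrier (cfun_algebra Y)" if "b \<in> B'" for b using that by (simp add: B'_def)
  have B'I: "b \<in> B'" if "b \<in> carrier (cfun_algebra Y)" "?p b \<in> B" for b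
    using that by (simp add: B'_def)
  have p_add: "?p (b \<oplus>\<^bsub>cfun_algebra Y\<^esub> c) = ?p b \<oplus>\<^bsub>cfun_algebra X\<^esub> ?p c" for b c
    by (rule ext) (simp add: cfun_algebra_def \<Phi>in)
  have p_mult: "?p (b \<otimes>\<^bsub>cfun_algebra Y\<^esub> c) = ?p b \<otimes>\<^bsub>cfun_algebra X\<^esub> ?p c" for b c
    by (rule ext) (simp add: cfun_algebra_def \<Phi>in)
  have p_smult: "?p (r \<odot>\<^bsub>cfun_algebra Y\<^esub> b) = r \<odot>\<^bsub>cfun_algebra X\<^esub> ?p b" for b r
    by (rule ext) (simp add: cfun_algebra_def \<Phi>in)
  have p_one: "?p \<one>\<^bsub>cfun_algebra Y\<^esub> = (\<lambda>x\<in>topspace X. 1)"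
    by (rule ext) (simp add: cfun_algebra_def \<Phi>in)
  have p_zero: "?p \<zero>\<^bsub>cfun_algebra Y\<^esub> = (\<lambda>x\<in>topspace X. 0)"
    by (rule ext) (simp add: cfun_algebra_def \<Phi>in)
  have one: "\<one>\<^bsub>cfun_algebra Y\<^esub> \<in> B'"
    by (rule B'I[OF C.one_closed]) (unfold p_one, rule const)
  have zero: "\<zero>\<^bsub>cfun_algebra Y\<^esub> \<in> B'"
    by (rule B'I[OF C.zero_closed]) (unfold p_zero, rule const)
  have add: "b \<oplus>\<^bsub>cfun_algebra Y\<^esub> c \<in> B'" if "b \<in> B'" "c \<in> B'" for b c
    by (rule B'I[OF C.a_closed[OF that[THEN B'c]]])
      (unfold p_add, rule subringE(7)[OF ring that[THEN pB]])
  have mult: "b \<otimes>\<^bsub>cfun_algebra Y\<^esub> c \<in> B'" if "b \<in> B'" "c \<in> B'" for b c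
    by (rule B'I[OF C.m_closed[OF that[THEN B'c]]])
      (unfold p_mult, rule subringE(6)[OF ring that[THEN pB]])
  have scal: "r \<in> carrier field_ring" for r :: 'f by (simp add: field_ring_def)
  have smul: "r \<odot>\<^bsub>cfun_algebra Y\<^esub> b \<in> B'" if "b \<in> B'" for b and r :: 'f
    by (rule B'I[OF smult_closed[OF scal B'c[OF that]]])
      (unfold p_smult, rule submodule.smult_closed[OF mod scal pB[OF that]])
  have uminus: "\<ominus>\<^bsub>cfun_algebra Y\<^esub> b \<in> B'" if "b \<in> B'" for b
  proof -
    have "(- 1) \<odot>\<^bsub>cfun_algebra Y\<^esub> b \<oplus>\<^bsub>cfun_algebra Y\<^esub> b = \<zero>\<^bsub>cfun_algebra Y\<^esub>"
      by (rule ext) (simp add: cfun_algebra_def)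
    hence "\<ominus>\<^bsub>cfun_algebra Y\<^esub> b = (- 1) \<odot>\<^bsub>cfun_algebra Y\<^esub> b"
      by (rule C.minus_equality[OF _ B'c[OF that] B'c[OF smul[OF that]]])
    thus ?thesis using smul[OF that, of "- 1"] by simp
  qed
  have h1: "subring B' (cfun_algebra Y)"
    by (rule C.subringI[OF _ one uminus mult add]) (use B'c in blast)
  have h2: "submodule B' field_ring (cfun_algebra Y)"
    by (rule submoduleI[OF _ zero uminus add smul]) (use B'c in blast)
  have h3: "\<forall>c. (\<lambda>y\<in>topspace Y. c) \<in> B'"
  proof (rule allI, rule B'I)
    fix c :: 'f
    have "?p (\<lambda>y\<in>topspace Y. c) = (\<lambda>x\<in>topspace X. c)" by (rule ext) (simp add: \<Phi>in)
    thus "?p (\<lambda>y\<in>topspace Y. c) \<in> B" using const[of c] by simp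
  qed (simp add: cfun_algebra_def)
  have h4: "\<forall>y\<in>topspace Y. \<forall>z\<in>topspace Y. y \<noteq> z \<longrightarrow> (\<exists>b\<in>B'. b y \<noteq> b z)"
  proof (intro ballI impI)
    fix y z assume yz: "y \<in> topspace Y" "z \<in> topspace Y" "y \<noteq> z"
    obtain V n where ne: "y (V, n) \<noteq> z (V, n)" using yz(3) by (auto simp: fun_eq_iff)
    let ?b = "\<lambda>w\<in>topspace Y. w (V, n)"
    have "continuous_map P euclidean (\<lambda>w. w (V, n))"
      unfolding P_def by (rule continuous_map_product_projection) simp
    hence "?b \<in> carrier (cfun_algebra Y)"
      unfolding Y_def cfun_algebra_def by (simp add: continuous_map_from_subtopology)
    moreover have "?p ?b = s V n"
    proof (rule extensionalityI)
      show "s V n \<in> extensional (topspace X)"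
        using subsetD[OF Bsub sB[of V n]] by (simp add: cfun_algebra_def)
      show "?p ?b x = s V n x" if "x \<in> topspace X" for x
        using that \<Phi>in[OF that] by (simp add: \<Phi>_def)
    qed simp
    ultimately have "?b \<in> B'" using sB[of V n] by (intro B'I) simp_all
    moreover have "?b y \<noteq> ?b z" using ne yz(1,2) by simp
    ultimately show "\<exists>b\<in>B'. b y \<noteq> b z" by (intro bexI[of _ ?b])
  qed
  have h5: "\<forall>\<phi> :: 'f \<Rightarrow> complex. complex_identification \<phi> \<longrightarrow>
      (\<forall>b\<in>B'. (\<lambda>y\<in>topspace Y. conj_along \<phi> (b y)) \<in> B')"
  proof (intro allI impI ballI)
    fix \<phi> :: "'f \<Rightarrow> complex" and b assume \<phi>: "complex_identification \<phi>" and b: "b \<in> B'"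
    have c1: "continuous_on UNIV \<phi>" and c2: "continuous_on UNIV (inv_into UNIV \<phi>)"
      using \<phi> by (simp_all only: complex_identification_def)
    have "continuous_on UNIV (conj_along \<phi>)"
      unfolding conj_along_def
      by (rule continuous_on_compose2[OF c2 continuous_on_cnj[OF c1] subset_UNIV])
    hence "continuous_map euclidean euclidean (conj_along \<phi>)"
      unfolding continuous_map_iff_continuous2 .
    moreover have "continuous_map Y euclidean b" using B'c[OF b] by (simp add: cfun_algebra_def)
    ultimately have "continuous_map Y euclidean (\<lambda>y. conj_along \<phi> (b y))"
      using continuous_map_compose[of Y euclidean b euclidean "conj_along \<phi>"] by (simp add: o_def)
    hence "(\<lambda>y\<in>topspace Y. conj_along \<phi> (b y)) \<in> carrier (cfun_algebra Y)"
      by (simp add: cfun_algebra_def)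
    moreover have "?p (\<lambda>y\<in>topspace Y. conj_along \<phi> (b y)) = (\<lambda>x\<in>topspace X. conj_along \<phi> (?p b x))"
      by (rule ext) (simp add: \<Phi>in)
    ultimately show "(\<lambda>y\<in>topspace Y. conj_along \<phi> (b y)) \<in> B'" using conj[OF \<phi> pB[OF b]] by (intro B'I) simp_all
  qed
  have h6: "restrict g (topspace Y) \<in> carrier (cfun_algebra Y)"
    using g(1) by (simp add: cfun_algebra_def)
  have h7: "stone_weierstrass_on TYPE('f) Y"
    using SW CY HY by (simp add: stone_weierstrass_def)
  have "\<exists>b\<in>B'. \<forall>y\<in>topspace Y. b y - restrict g (topspace Y) y \<in> U"
    by (rule h7[unfolded stone_weierstrass_on_def, THEN spec, THEN mp,
          OF conjI[OF h1 conjI[OF h2 conjI[OF h3 conjI[OF h4 h5]]]],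
          THEN bspec, OF h6, THEN spec, THEN mp, OF U])
  then obtain b where b: "b \<in> B'" "\<forall>y\<in>topspace Y. b y - restrict g (topspace Y) y \<in> U"
    by (rule bexE)
  have "?p b x - f x \<in> U" if "x \<in> topspace X" for x
    using b(2)[rule_format, OF \<Phi>in[OF that]] that g(2)[OF that] \<Phi>in[OF that] by simp
  thus "\<exists>g\<in>B. \<forall>x\<in>topspace X. g x - f x \<in> U"
    using pB[OF b(1)] by (intro bexI[of _ "?p b"] ballI)
qed

end

theory Submission
  imports Defs
begin

text \<open>
  The maximal ideals of a Gelfand algebra \<open>A\<close> are the kernels of its characters, that is, of the
  unital algebra homomorphisms \<open>A \<rightarrow> F\<close>.  Both directions are statements about the space of
  characters.

  Let \<open>A\<close> be the algebra of continuous functions on a compact \<open>F\<close>-Tychonoff space \<open>X\<close>.  The main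
  point is that every proper ideal has a common zero (\<open>proper_ideal_has_common_zero\<close>), which is
  derived from the Stone-Weierstrass property.  Hence the maximal ideals are the ideals of functions
  vanishing at a point, the spectrum of a function is its compact range, and \<open>A\<close> is Gelfand and
  semisimple.  Functions with disjoint supports around two points show that a prime ideal
  lies in one maximal ideal only.  The canonical uniformity is that of uniform convergence, for
  which the continuous functions into a complete field are complete.

  Conversely, the characters of \<open>A\<close> form a closed subspace of the product of the spectra,
  which is compact.  The Gelfand transform, which sends \<open>a\<close> to the function \<open>\<xi> \<mapsto> \<xi>(a)\<close>, is
  injective since \<open>A\<close> is semisimple, its image is dense by Stone-Weierstrass
  (\<open>gelfand_transform_dense\<close>), and completeness makes it surjective
  (\<open>gelfand_transform_surj\<close>).  Over \<open>\<complex>\<close> the density needs the image to be closed under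
  conjugation, which \<open>conj_closed_algebra\<close> provides.  The condition on prime ideals is what makes the character space
  \<open>F\<close>-Tychonoff: it provides, for two maximal ideals, elements \<open>a\<close> and \<open>b\<close> with \<open>a b = 0\<close>,
  the first outside one ideal and the second outside the other (\<open>separating_annihilators\<close>), and
  finitely many such pairs separate a point from a closed set (\<open>F_Tychonoff_char_space\<close>).
\<close>

section \<open>Continuous functions into a topological field\<close>

lemma continuous_map_field_iff:
  "continuous_map X euclidean f \<longleftrightarrow>
     (\<forall>x\<in>topspace X. ((f :: _ \<Rightarrow> 'f::topological_field) \<longlongrightarrow> f x) (atin X x))"
  by (simp add: continuous_map_atin)

lemma
  fixes f g :: "'x \<Rightarrow> 'f::topological_field"
  assumes "continuous_map X euclidean f" "continuous_map X euclidean g"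
  shows continuous_map_field_add: "continuous_map X euclidean (\<lambda>x. f x + g x)"
    and continuous_map_field_diff: "continuous_map X euclidean (\<lambda>x. f x - g x)"
    and continuous_map_field_mult: "continuous_map X euclidean (\<lambda>x. f x * g x)"
  using assms unfolding continuous_map_field_iff by (auto intro!: tendsto_intros)

lemma continuous_map_field_inverse:
  fixes f :: "'x \<Rightarrow> 'f::topological_field"
  assumes "continuous_map X euclidean f" "\<And>x. x \<in> topspace X \<Longrightarrow> f x \<noteq> 0"
  shows "continuous_map X euclidean (\<lambda>x. inverse (f x))"
  using assms unfolding continuous_map_field_iff
  by (auto intro: filterlim_compose[OF tendsto_inverse_nhds])

lemma Hausdorff_space_euclidean_t2: "Hausdorff_space (euclidean :: 'f::t2_space topology)"
  unfolding Hausdorff_space_def disjnt_def by (simp, metis hausdorff)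

text \<open>
  Symmetric neighbourhoods \<open>V\<close> of \<open>0\<close> with \<open>V + V \<subseteq> U\<close> take the place of the
  \<open>\<epsilon>/2\<close> of the metric case in every uniform estimate below.
\<close>

lemma open_symmetric_half_nhd:
  fixes U :: "'f::topological_field set"
  assumes "open U" "0 \<in> U"
  obtains V where "open V" "0 \<in> V" "uminus ` V = V" "\<And>x y. x \<in> V \<Longrightarrow> y \<in> V \<Longrightarrow> x + y \<in> U"
proof -
  have "continuous_on UNIV (\<lambda>p::'f\<times>'f. fst p + snd p)"
    unfolding continuous_on_def by (intro ballI tendsto_intros)
  hence "open ((\<lambda>p. fst p + snd p) -` U)" by (rule open_vimage[OF assms(1)])
  moreover have "(0, 0) \<in> (\<lambda>p. fst p + snd p) -` U" using assms(2) by simp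
  ultimately obtain P Q where PQ: "open P" "open Q" "(0, 0) \<in> P \<times> Q"
    "P \<times> Q \<subseteq> (\<lambda>p. fst p + snd p) -` U"
    by (rule open_prod_elim)
  define W where "W = P \<inter> Q"
  have c: "continuous_on UNIV (uminus :: 'f \<Rightarrow> 'f)"
    unfolding continuous_on_def by (intro ballI tendsto_intros)
  have "open (uminus -` W)"
    by (rule open_vimage[OF _ c]) (use PQ W_def in auto)
  hence "open (W \<inter> uminus -` W)" using PQ by (auto simp: W_def)
  moreover have "0 \<in> W \<inter> uminus -` W" using PQ by (auto simp: W_def)
  moreover have "uminus ` (W \<inter> uminus -` W) = W \<inter> uminus -` W"
    by (force simp: image_iff)
  moreover have "x + y \<in> U" if "x \<in> W \<inter> uminus -` W" "y \<in> W \<inter> uminus -` W" for x y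
    using that PQ(4) by (auto simp: W_def)
  ultimately show ?thesis by (rule that)
qed

lemma symmetric_nhd_minus:
  fixes V :: "'f::ab_group_add set"
  assumes "uminus ` V = V" "x \<in> V"
  shows "- x \<in> V"
  using assms by blast

text \<open>
  A function with values \<open>1\<close> and \<open>0\<close> at two points pulls back disjoint neighbourhoods of
  \<open>1\<close> and \<open>0\<close> in the Hausdorff space \<open>F\<close>.
\<close>

lemma F_Tychonoff_imp_Hausdorff:
  assumes "F_Tychonoff TYPE('f::topological_field) X"
  shows "Hausdorff_space X"
  unfolding Hausdorff_space_def
proof (intro allI impI)
  fix x y assume xy: "x \<in> topspace X \<and> y \<in> topspace X \<and> x \<noteq> y"
  have "closedin X {y}" using assms xy by (simp add: F_Tychonoff_def closedin_t1_singleton)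
  then obtain f :: "_ \<Rightarrow> 'f" where f: "continuous_map X euclidean f" "f x = 1" "f y = 0"
    using assms xy unfolding F_Tychonoff_def by (metis Diff_iff insertI1 singletonD)
  obtain U V :: "'f set" where UV: "open U" "open V" "1 \<in> U" "0 \<in> V" "U \<inter> V = {}"
    using hausdorff[of "1::'f" 0] by auto
  show "\<exists>U V. openin X U \<and> openin X V \<and> x \<in> U \<and> y \<in> V \<and> disjnt U V"
    using UV f xy
    by (intro exI[of _ "{x \<in> topspace X. f x \<in> U}"] exI[of _ "{x \<in> topspace X. f x \<in> V}"])
      (auto simp: disjnt_iff intro!: openin_continuous_map_preimage[OF f(1)])
qed


section \<open>Complex conjugation on the scalars\<close>

text \<open>
  A field endomorphism fixes \<open>\<rat>\<close>, a continuous one therefore fixes the closure \<open>\<real>\<close>, and the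
  image of \<open>\<i>\<close> is one of the two square roots of \<open>-1\<close>.
\<close>

lemma continuous_complex_field_endomorphism:
  fixes \<theta> :: "complex \<Rightarrow> complex"
  assumes add: "\<And>x y. \<theta> (x + y) = \<theta> x + \<theta> y" and mult: "\<And>x y. \<theta> (x * y) = \<theta> x * \<theta> y"
    and one: "\<theta> 1 = 1" and cont: "continuous_on UNIV \<theta>"
  shows "\<theta> = id \<or> \<theta> = cnj"
proof -
  have zero: "\<theta> 0 = 0" using add[of 0 0] by simp
  have nat: "\<theta> (of_nat n) = of_nat n" for n by (induction n) (simp_all add: zero one add)
  have minus: "\<theta> (- x) = - \<theta> x" for x using add[of x "- x"] zero by (simp add: eq_neg_iff_add_eq_0 add.commute)
  have int: "\<theta> (of_int n) = of_int n" for n by (cases n rule: int_cases2) (simp_all add: nat minus)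
  have rat: "\<theta> (of_real r) = of_real r" if rr: "r \<in> \<rat>" for r
  proof -
    obtain a b :: int where ab: "b \<noteq> 0" "r = of_int a / of_int b"
      by (rule Rats_cases'[OF rr]) (metis that less_irrefl)
    have "complex_of_real (r * of_int b) = of_int a" using ab by simp
    hence eq: "complex_of_real r * of_int b = of_int a" by simp
    hence "\<theta> (of_real r) * of_int b = of_real r * of_int b"
      using mult[of "of_real r" "of_int b"] by (simp only: int)
    thus ?thesis using ab(1) by simp
  qed
  have "closed {r. \<theta> (complex_of_real r) = of_real r}"
    by (intro closed_Collect_eq continuous_intros continuous_on_compose2[OF cont]) auto
  hence "closure \<rat> \<subseteq> {r. \<theta> (complex_of_real r) = of_real r}"
    using rat by (intro closure_minimal) auto
  hence real: "\<theta> (of_real r) = of_real r" for r by (auto simp: Rats_closure_real)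
  have "\<theta> \<i> * \<theta> \<i> = - 1" using mult[of \<i> \<i>] minus[of 1] one by simp
  hence "(\<theta> \<i> - \<i>) * (\<theta> \<i> + \<i>) = 0" by (simp add: algebra_simps)
  hence i: "\<theta> \<i> = \<i> \<or> \<theta> \<i> = - \<i>" by (auto simp: eq_neg_iff_add_eq_0)
  have z: "\<theta> z = of_real (Re z) + \<theta> \<i> * of_real (Im z)" for z
    by (subst complex_eq[of z]) (simp add: add mult real)
  show ?thesis using i
  proof
    assume "\<theta> \<i> = \<i>"
    hence "\<theta> x = id x" for x by (subst z) (simp add: complex_eq_iff)
    hence "\<theta> = id" by (rule ext)
    thus ?thesis ..
  next
    assume "\<theta> \<i> = - \<i>"
    hence "\<theta> x = cnj x" for x by (subst z) (simp add: complex_eq_iff)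
    hence "\<theta> = cnj" by (rule ext)
    thus ?thesis ..
  qed
qed

text \<open>
  Both identity and conjugation commute with conjugation, so conjugation can be transported along
  any identification of the scalars with \<open>\<complex>\<close> with the same result.  This reduces the
  infinitely many closure conditions over all identifications to a single one.
\<close>

lemma conj_along_unique:
  fixes \<phi> \<psi> :: "'f::topological_field \<Rightarrow> complex"
  assumes "complex_identification \<phi>" "complex_identification \<psi>"
  shows "conj_along \<phi> = conj_along \<psi>"
proof -
  note \<phi> = assms(1)[unfolded complex_identification_def]
  note \<psi> = assms(2)[unfolded complex_identification_def]
  define \<theta> where "\<theta> = \<phi> \<circ> inv_into UNIV \<psi>"
  have b: "bij \<phi>" "bij \<psi>" using \<phi> \<psi> by auto
  have r: "\<psi> (inv_into UNIV \<psi> z) = z" "inv_into UNIV \<psi> (\<psi> x) = x" "inv_into UNIV \<phi> (\<phi> x) = x" for x z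
    using b by (auto simp: bij_is_surj surj_f_inv_f bij_is_inj)
  have iadd: "inv_into UNIV \<psi> (x + y) = inv_into UNIV \<psi> x + inv_into UNIV \<psi> y" for x y
    using \<psi> r by metis
  have imult: "inv_into UNIV \<psi> (x * y) = inv_into UNIV \<psi> x * inv_into UNIV \<psi> y" for x y
    using \<psi> r by metis
  have mult: "\<theta> (x * y) = \<theta> x * \<theta> y" for x y
    using \<phi> by (simp add: \<theta>_def imult)
  have ne: "\<theta> 0 \<noteq> \<theta> 1"
    by (simp add: \<theta>_def) (metis r zero_neq_one)
  have zero: "\<theta> 0 = 0" using ne mult[of 0 0] mult[of 0 1] by auto
  have one: "\<theta> 1 = 1" using ne zero mult[of 1 1] by auto
  have "continuous_on UNIV \<theta>"
    unfolding \<theta>_def o_def using \<phi> \<psi> by (auto intro: continuous_on_compose2)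
  hence "\<theta> = id \<or> \<theta> = cnj"
    using \<phi> by (intro continuous_complex_field_endomorphism mult one) (auto simp: \<theta>_def iadd)
  hence c: "\<theta> (cnj z) = cnj (\<theta> z)" for z by auto
  have "\<phi> (conj_along \<psi> x) = cnj (\<phi> x)" for x
    using c[of "\<psi> x"] by (simp add: \<theta>_def conj_along_def r)
  thus ?thesis by (auto simp: conj_along_def fun_eq_iff) (metis r(3))
qed

text \<open>
  The identity over a field other than \<open>\<complex>\<close>, which lets one argument treat all fields alike.
\<close>

definition scalar_conj :: "'f::topological_field \<Rightarrow> 'f" where
  "scalar_conj =
     (if \<exists>\<phi> :: 'f \<Rightarrow> complex. complex_identification \<phi>
      then conj_along (SOME \<phi>. complex_identification \<phi>) else id)"

lemma conj_along_eq_scalar_conj: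
  assumes "complex_identification \<phi>"
  shows "conj_along \<phi> = scalar_conj"
  using assms unfolding scalar_conj_def by (metis conj_along_unique someI)

lemma scalar_conj:
  fixes x y :: "'f::topological_field"
  shows scalar_conj_add: "scalar_conj (x + y) = scalar_conj x + scalar_conj y"
    and scalar_conj_mult: "scalar_conj (x * y) = scalar_conj x * scalar_conj y"
    and scalar_conj_conj: "scalar_conj (scalar_conj x) = x"
    and continuous_scalar_conj: "continuous_on UNIV (scalar_conj :: 'f \<Rightarrow> 'f)"
proof -
  consider (complex) \<phi> :: "'f \<Rightarrow> complex" where "complex_identification \<phi>" "scalar_conj = conj_along \<phi>"
    | (other) "scalar_conj = (id :: 'f \<Rightarrow> 'f)"
    using conj_along_eq_scalar_conj unfolding scalar_conj_def by (metis (no_types, lifting))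
  hence "scalar_conj (x + y) = scalar_conj x + scalar_conj y \<and>
    scalar_conj (x * y) = scalar_conj x * scalar_conj y \<and>
    scalar_conj (scalar_conj x) = x \<and> continuous_on UNIV (scalar_conj :: 'f \<Rightarrow> 'f)"
  proof cases
    case complex
    note \<phi> = complex(1)[unfolded complex_identification_def]
    have r: "\<phi> (inv_into UNIV \<phi> z) = z" "inv_into UNIV \<phi> (\<phi> x) = x" for x z
      using \<phi> by (auto simp: bij_is_surj surj_f_inv_f bij_is_inj)
    have "continuous_on UNIV (conj_along \<phi>)"
      unfolding conj_along_def using \<phi>
      by (auto intro: continuous_on_compose2[of UNIV "inv_into UNIV \<phi>"] continuous_on_cnj)
    moreover have "inv_into UNIV \<phi> (a + b) = inv_into UNIV \<phi> a + inv_into UNIV \<phi> b" "inv_into UNIV \<phi> (a * b) = inv_into UNIV \<phi> a * inv_into UNIV \<phi> b" for a b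
      using \<phi> r by metis+
    ultimately show ?thesis using \<phi> unfolding complex(2) by (simp add: conj_along_def r)
  qed simp
  thus "scalar_conj (x + y) = scalar_conj x + scalar_conj y"
    "scalar_conj (x * y) = scalar_conj x * scalar_conj y"
    "scalar_conj (scalar_conj x) = x" "continuous_on UNIV (scalar_conj :: 'f \<Rightarrow> 'f)"
    by auto
qed

lemma scalar_conj_0 [simp]: "scalar_conj 0 = 0"
  by (metis scalar_conj_add add_0 add_cancel_right_right)

lemma scalar_conj_eq_0_iff [simp]: "scalar_conj x = 0 \<longleftrightarrow> x = 0"
  by (metis scalar_conj_conj scalar_conj_0)

lemma continuous_map_scalar_conj:
  assumes "continuous_map X euclidean f"
  shows "continuous_map X euclidean (\<lambda>x. scalar_conj (f x))"
  using continuous_map_compose[OF assms, of euclidean scalar_conj] continuous_scalar_conj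
  by (simp add: o_def)



section \<open>Characters of an algebra\<close>

lemma (in cring) ideal_criterion:
  assumes "I \<subseteq> carrier R" "\<zero> \<in> I" "\<And>a b. a \<in> I \<Longrightarrow> b \<in> I \<Longrightarrow> a \<oplus> b \<in> I"
    and mult: "\<And>a x. a \<in> I \<Longrightarrow> x \<in> carrier R \<Longrightarrow> x \<otimes> a \<in> I"
  shows "ideal I R"
proof (rule idealI)
  show "ring R" by (rule ring_axioms)
  show "subgroup I (add_monoid R)"
  proof (rule add.subgroupI)
    show "\<ominus> a \<in> I" if "a \<in> I" for a
      using mult[OF that, of "\<ominus> \<one>"] that assms(1) by (simp add: l_minus subset_iff)
  qed (use assms in auto)
  show "x \<otimes> a \<in> I" "a \<otimes> x \<in> I" if "a \<in> I" "x \<in> carrier R" for a x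
    using mult[OF that] that assms(1) by (auto simp: m_comm subset_iff)
qed

text \<open>
  The map \<open>scalar\<close> below maps the field to \<open>A\<close>, and by \<open>smult_conv_mult\<close> the module
  structure is multiplication in \<open>A\<close> by its values.  Computations thus take place in the ring \<open>A\<close>.
\<close>

locale field_algebra = cring A for A :: "('f::topological_field, 'a, 'm) module_scheme" (structure) +
  assumes algebra: "Module.algebra field_ring A"
begin

definition scalar :: "'f \<Rightarrow> 'a" where
  "scalar c = c \<odot> \<one>"

lemma in_field_ring: "c \<in> carrier field_ring"
  by (simp add: field_ring_def)

lemmas module_A = Module.algebra.module[OF algebra]

lemma smult_closed: "a \<in> carrier A \<Longrightarrow> c \<odot> a \<in> carrier A"
  by (rule module.smult_closed[OF module_A in_field_ring])

lemma smult_conv_mult: "a \<in> carrier A \<Longrightarrow> c \<odot> a = scalar c \<otimes> a"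
  using algebra.smult_assoc2[OF algebra in_field_ring one_closed, of a c] by (simp add: scalar_def)

lemma scalar_closed [simp]: "scalar c \<in> carrier A"
  by (simp add: scalar_def smult_closed)

lemma scalar_add: "scalar (c + d) = scalar c \<oplus> scalar d"
  using module.smult_l_distr[OF module_A in_field_ring in_field_ring one_closed, of c d]
  by (simp add: scalar_def field_ring_def)

lemma scalar_mult: "scalar (c * d) = scalar c \<otimes> scalar d"
  using module.smult_assoc1[OF module_A in_field_ring in_field_ring one_closed, of c d]
    smult_conv_mult[OF scalar_closed, of c d]
  by (simp add: scalar_def field_ring_def)

lemma scalar_1 [simp]: "scalar 1 = \<one>"
  using module.smult_one[OF module_A one_closed] by (simp add: scalar_def field_ring_def)

lemma scalar_0 [simp]: "scalar 0 = \<zero>"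
  using scalar_add[of 0 0] by (metis add.r_cancel_one' add_0 scalar_closed)

text \<open>
  The set \<open>characters\<close> below consists of the characters that are undefined outside the carrier,
  since these are the points of a product of copies of \<open>F\<close> indexed by the carrier.
\<close>

definition character :: "('a \<Rightarrow> 'f) \<Rightarrow> bool" where
  "character \<xi> \<longleftrightarrow>
     (\<forall>a\<in>carrier A. \<forall>b\<in>carrier A. \<xi> (a \<oplus> b) = \<xi> a + \<xi> b) \<and>
     (\<forall>a\<in>carrier A. \<forall>b\<in>carrier A. \<xi> (a \<otimes> b) = \<xi> a * \<xi> b) \<and>
     (\<forall>c. \<xi> (scalar c) = c)"

definition char_kernel :: "('a \<Rightarrow> 'f) \<Rightarrow> 'a set" where
  "char_kernel \<xi> = {a \<in> carrier A. \<xi> a = 0}"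

lemma
  assumes "character \<xi>"
  shows character_scalar: "\<xi> (scalar c) = c"
    and character_one: "\<xi> \<one> = 1"
    and character_zero: "\<xi> \<zero> = 0"
    and character_add: "\<lbrakk>a \<in> carrier A; b \<in> carrier A\<rbrakk> \<Longrightarrow> \<xi> (a \<oplus> b) = \<xi> a + \<xi> b"
    and character_mult: "\<lbrakk>a \<in> carrier A; b \<in> carrier A\<rbrakk> \<Longrightarrow> \<xi> (a \<otimes> b) = \<xi> a * \<xi> b"
    and character_uminus: "a \<in> carrier A \<Longrightarrow> \<xi> (\<ominus> a) = - \<xi> a"
    and character_minus: "\<lbrakk>a \<in> carrier A; b \<in> carrier A\<rbrakk> \<Longrightarrow> \<xi> (a \<ominus> b) = \<xi> a - \<xi> b"
proof -
  show s: "\<xi> (scalar c) = c" for c using assms by (simp add: character_def)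
  show "\<xi> \<one> = 1" and z: "\<xi> \<zero> = 0" using s[of 1] s[of 0] by simp_all
  show add: "\<xi> (a \<oplus> b) = \<xi> a + \<xi> b" if "a \<in> carrier A" "b \<in> carrier A" for a b
    using assms that by (simp add: character_def)
  show "\<xi> (a \<otimes> b) = \<xi> a * \<xi> b" if "a \<in> carrier A" "b \<in> carrier A" for a b
    using assms that by (simp add: character_def)
  show m: "\<xi> (\<ominus> a) = - \<xi> a" if "a \<in> carrier A" for a
    using add[of "\<ominus> a" a] that z by (simp add: l_neg eq_neg_iff_add_eq_0)
  show "\<xi> (a \<ominus> b) = \<xi> a - \<xi> b" if "a \<in> carrier A" "b \<in> carrier A" for a b
    using add[of a "\<ominus> b"] m[of b] that by (simp add: a_minus_def)
qed

lemma character_restrict: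
  assumes "character \<xi>"
  shows "character (restrict \<xi> (carrier A))"
  using assms by (simp add: character_def)

lemma char_kernel_ideal:
  assumes "character \<xi>"
  shows "ideal (char_kernel \<xi>) A"
  by (rule ideal_criterion)
    (auto simp: char_kernel_def character_zero[OF assms] character_add[OF assms] character_mult[OF assms])

lemma diff_scalar_in_char_kernel:
  assumes "character \<xi>" "a \<in> carrier A"
  shows "a \<ominus> scalar c \<in> char_kernel \<xi> \<longleftrightarrow> c = \<xi> a"
  using assms by (auto simp: char_kernel_def character_minus character_scalar)

lemma ideal_decompose:
  assumes "ideal I A" "a \<in> carrier A" "b \<in> I" "a \<ominus> b \<in> I"
  shows "a \<in> I"
proof -
  interpret I: ideal I A by (rule assms(1))
  have "a = (a \<ominus> b) \<oplus> b" using assms(2) I.Icarr[OF assms(3)] by algebra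
  thus ?thesis using I.a_closed[OF assms(4,3)] by simp
qed

text \<open>
  Outside the kernel \<open>a\<close> is a nonzero scalar modulo the kernel, hence invertible modulo it.
\<close>

lemma char_kernel_maximal:
  assumes \<xi>: "character \<xi>"
  shows "maximalideal (char_kernel \<xi>) A"
proof (rule maximalidealI)
  show "ideal (char_kernel \<xi>) A" by (rule char_kernel_ideal[OF \<xi>])
  show "carrier A \<noteq> char_kernel \<xi>"
  proof
    assume "carrier A = char_kernel \<xi>"
    hence "\<one> \<in> char_kernel \<xi>" using one_closed by simp
    thus False using character_one[OF \<xi>] by (simp add: char_kernel_def)
  qed
next
  fix J assume J: "ideal J A" "char_kernel \<xi> \<subseteq> J" "J \<subseteq> carrier A"
  interpret J: ideal J A by (rule J(1))
  show "J = char_kernel \<xi> \<or> J = carrier A"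
  proof (rule ccontr)
    assume ne: "\<not> (J = char_kernel \<xi> \<or> J = carrier A)"
    then obtain a where a: "a \<in> J" "\<xi> a \<noteq> 0" using J by (auto simp: char_kernel_def)
    have ac: "a \<in> carrier A" using a J by auto
    have "scalar (inverse (\<xi> a)) \<otimes> a \<in> J" using J.I_l_closed[OF a(1)] by simp
    moreover have "\<one> \<ominus> scalar (inverse (\<xi> a)) \<otimes> a \<in> char_kernel \<xi>"
      using ac a(2) \<xi>
      by (simp add: char_kernel_def character_minus character_mult character_scalar character_one)
    ultimately have "\<one> \<in> J" using J by (intro ideal_decompose[OF J(1) one_closed]) auto
    thus False using ne J.one_imp_carrier by simp
  qed
qed

lemma value_at_char_kernel:
  assumes \<xi>: "character \<xi>" and a: "a \<in> carrier A"
  shows "value_at A (char_kernel \<xi>) a = \<xi> a"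
proof -
  have "char_kernel \<xi> +> a = char_kernel \<xi> +> c \<odot> \<one> \<longleftrightarrow> c = \<xi> a" for c
    using quotient_eq_iff_same_a_r_cos[OF char_kernel_ideal[OF \<xi>] a scalar_closed, of c]
      diff_scalar_in_char_kernel[OF \<xi> a, of c]
    by (simp add: scalar_def)
  thus ?thesis by (simp add: value_at_def)
qed

text \<open>
  This lemma and the next identify the Gelfand property with the statement that the maximal ideals
  are exactly the kernels of characters.  Afterwards quotient rings no longer occur.
\<close>

lemma gelfandI:
  assumes "\<And>M. M \<in> Max_ideals A \<Longrightarrow> \<exists>\<xi>. character \<xi> \<and> M = char_kernel \<xi>"
  shows "gelfand_algebra A"
  unfolding gelfand_algebra_def
proof
  fix M assume "M \<in> Max_ideals A"
  then obtain \<xi> where \<xi>: "character \<xi>" "M = char_kernel \<xi>" using assms by blast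
  interpret M: ideal M A using char_kernel_ideal[OF \<xi>(1)] \<xi>(2) by simp
  have sc: "(\<lambda>c. M +> c \<odot> \<one>) = (+>) M \<circ> scalar" by (simp add: scalar_def fun_eq_iff)
  have "scalar \<in> ring_hom field_ring A"
    by (rule ring_hom_memI) (simp_all add: field_ring_def scalar_add scalar_mult)
  hence hom: "(+>) M \<circ> scalar \<in> ring_hom field_ring (A Quot M)"
    by (rule ring_hom_trans[OF _ M.rcos_ring_hom])
  have eq: "M +> a = M +> scalar c \<longleftrightarrow> c = \<xi> a" if "a \<in> carrier A" for a c
    using quotient_eq_iff_same_a_r_cos[OF M.is_ideal that scalar_closed, of c]
      diff_scalar_in_char_kernel[OF \<xi>(1) that, of c] \<xi>(2) by simp
  have "bij_betw ((+>) M \<circ> scalar) (carrier field_ring) (carrier (A Quot M))"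
  proof (rule bij_betwI')
    show "((+>) M \<circ> scalar) x = ((+>) M \<circ> scalar) y \<longleftrightarrow> x = y" for x y
      using eq[OF scalar_closed, of x y] character_scalar[OF \<xi>(1)] by auto
    show "((+>) M \<circ> scalar) x \<in> carrier (A Quot M)" for x
      using ring_hom_closed[OF hom in_field_ring] .
    fix y assume "y \<in> carrier (A Quot M)"
    then obtain a where "a \<in> carrier A" "y = M +> a"
      by (auto simp: FactRing_def A_RCOSETS_def')
    thus "\<exists>x\<in>carrier field_ring. y = ((+>) M \<circ> scalar) x"
      using eq by (intro bexI[of _ "\<xi> a"]) (auto simp: in_field_ring)
  qed
  thus "(\<lambda>c. M +> c \<odot> \<one>) \<in> ring_iso field_ring (A Quot M)"
    using hom unfolding sc by (simp add: ring_iso_def)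
qed

text \<open>
  Each \<open>a\<close> is congruent to exactly one scalar modulo \<open>M\<close>, and congruences can be added and
  multiplied.
\<close>

lemma maximal_ideal_of_gelfand:
  assumes "gelfand_algebra A" "M \<in> Max_ideals A"
  shows "character (value_at A M)" "char_kernel (value_at A M) = M"
proof -
  interpret M: maximalideal M A using assms(2) by (simp add: Max_ideals_def)
  have iso: "(\<lambda>c. M +> scalar c) \<in> ring_iso field_ring (A Quot M)"
    using assms by (simp add: gelfand_algebra_def scalar_def)
  have inM: "M +> a = M +> scalar c \<longleftrightarrow> a \<ominus> scalar c \<in> M" if "a \<in> carrier A" for a c
    using quotient_eq_iff_same_a_r_cos[OF M.is_ideal that scalar_closed] by simp
  have ex: "\<exists>!c. a \<ominus> scalar c \<in> M" if a: "a \<in> carrier A" for a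
  proof -
    have "M +> a \<in> carrier (A Quot M)" using a by (auto simp: FactRing_def A_RCOSETS_def')
    then obtain c where "M +> a = M +> scalar c"
      using ring_iso_memE(5)[OF iso] by (auto simp: bij_betw_def)
    moreover have "c = d" if "M +> a = M +> scalar c" "M +> a = M +> scalar d" for c d
      using ring_iso_memE(5)[OF iso] that by (auto simp: bij_betw_def inj_on_def in_field_ring)
    ultimately show ?thesis using inM[OF a] by metis
  qed
  have v: "a \<ominus> scalar (value_at A M a) \<in> M" if "a \<in> carrier A" for a
    using theI'[OF ex[OF that]] inM[OF that] by (simp add: value_at_def scalar_def)
  have vI: "value_at A M a = c" if "a \<in> carrier A" "a \<ominus> scalar c \<in> M" for a c
    using ex[OF that(1)] v[OF that(1)] that(2) by blast
  show ch: "character (value_at A M)"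
    unfolding character_def
  proof (intro conjI ballI allI)
    fix a b assume ab: "a \<in> carrier A" "b \<in> carrier A"
    define c d where "c = scalar (value_at A M a)" "d = scalar (value_at A M b)"
    have cd: "c \<in> carrier A" "d \<in> carrier A" by (simp_all add: c_d_def)
    have in_M: "a \<ominus> c \<in> M" "b \<ominus> d \<in> M" using v ab by (simp_all add: c_d_def)
    have "(a \<oplus> b) \<ominus> (c \<oplus> d) = (a \<ominus> c) \<oplus> (b \<ominus> d)" using ab cd by algebra
    hence "(a \<oplus> b) \<ominus> scalar (value_at A M a + value_at A M b) \<in> M"
      using M.a_closed[OF in_M] by (simp add: c_d_def scalar_add)
    thus "value_at A M (a \<oplus> b) = value_at A M a + value_at A M b" using ab by (intro vI) auto
    have "(a \<otimes> b) \<ominus> (c \<otimes> d) = a \<otimes> (b \<ominus> d) \<oplus> d \<otimes> (a \<ominus> c)" using ab cd by algebra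
    hence "(a \<otimes> b) \<ominus> scalar (value_at A M a * value_at A M b) \<in> M"
      using M.a_closed[OF M.I_l_closed[OF in_M(2) ab(1)] M.I_l_closed[OF in_M(1) cd(2)]]
      by (simp add: c_d_def scalar_mult)
    thus "value_at A M (a \<otimes> b) = value_at A M a * value_at A M b" using ab by (intro vI) auto
  next
    fix c show "value_at A M (scalar c) = c"
      by (rule vI) (simp_all add: a_minus_def r_neg M.zero_closed)
  qed
  have "value_at A M a = 0 \<longleftrightarrow> a \<in> M" if "a \<in> carrier A" for a
    using v[OF that] vI[OF that, of 0] that by (auto simp: a_minus_def)
  thus "char_kernel (value_at A M) = M" using M.a_subset by (auto simp: char_kernel_def)
qed

definition characters :: "('a \<Rightarrow> 'f) set" where
  "characters = {\<xi> \<in> extensional (carrier A). character \<xi>}"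

lemma in_charactersD:
  assumes "\<xi> \<in> characters"
  shows "character \<xi>" "\<xi> \<in> extensional (carrier A)"
  using assms by (simp_all add: characters_def)

lemma char_kernel_in_Max_ideals: "\<xi> \<in> characters \<Longrightarrow> char_kernel \<xi> \<in> Max_ideals A"
  by (simp add: Max_ideals_def char_kernel_maximal in_charactersD)

lemma characters_eqI:
  assumes "\<xi> \<in> characters" "\<psi> \<in> characters" "\<And>a. a \<in> carrier A \<Longrightarrow> \<xi> a = \<psi> a"
  shows "\<xi> = \<psi>"
  using assms by (auto intro: extensionalityI[of _ "carrier A"] dest: in_charactersD)

text \<open>
  The element \<open>a - \<xi>(a)\<close> lies in the kernel of \<open>\<xi>\<close>, so inclusion of kernels already forces
  equality of the characters.
\<close>

lemma character_eqI:
  assumes "character \<xi>" "character \<psi>" "char_kernel \<xi> \<subseteq> char_kernel \<psi>" "a \<in> carrier A"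
  shows "\<xi> a = \<psi> a"
  using assms diff_scalar_in_char_kernel[of \<xi> a "\<xi> a"] diff_scalar_in_char_kernel[of \<psi> a "\<xi> a"]
  by auto

text \<open>
  Transfers conditions on maximal ideals to the points of the character space.
\<close>

lemma all_Max_ideals_iff:
  assumes "gelfand_algebra A"
  shows "(\<forall>M\<in>Max_ideals A. P (restrict (value_at A M) (carrier A))) \<longleftrightarrow> (\<forall>\<xi>\<in>characters. P \<xi>)"
proof safe
  fix \<xi> assume P: "\<forall>M\<in>Max_ideals A. P (restrict (value_at A M) (carrier A))" and \<xi>: "\<xi> \<in> characters"
  have "restrict (value_at A (char_kernel \<xi>)) (carrier A) = \<xi>"
    using \<xi> by (intro extensionalityI[of _ "carrier A"])
      (auto simp: value_at_char_kernel in_charactersD)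
  thus "P \<xi>" using P char_kernel_in_Max_ideals[OF \<xi>] by metis
next
  fix M assume "\<forall>\<xi>\<in>characters. P \<xi>" "M \<in> Max_ideals A"
  thus "P (restrict (value_at A M) (carrier A))"
    using maximal_ideal_of_gelfand(1)[OF assms]
    by (auto simp: characters_def intro: character_restrict)
qed

lemma canonical_entourage_characters:
  assumes "gelfand_algebra A"
  shows "canonical_entourage A U =
    {(a, b) \<in> carrier A \<times> carrier A. \<forall>\<xi>\<in>characters. \<xi> b - \<xi> a \<in> U}"
proof -
  have "(\<forall>M\<in>Max_ideals A. value_at A M (b \<ominus> a) \<in> U) \<longleftrightarrow> (\<forall>\<xi>\<in>characters. \<xi> b - \<xi> a \<in> U)"
    if "a \<in> carrier A" "b \<in> carrier A" for a b
    using all_Max_ideals_iff[OF assms, of "\<lambda>\<xi>. \<xi> (b \<ominus> a) \<in> U"] that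
    by (auto simp: character_minus in_charactersD)
  thus ?thesis by (auto simp: canonical_entourage_def)
qed

lemma character_in_spectrum:
  assumes "character \<xi>" "a \<in> carrier A"
  shows "\<xi> a \<in> spectrum_of A a"
proof -
  have "a \<ominus> scalar (\<xi> a) \<notin> Units A"
  proof
    let ?u = "a \<ominus> scalar (\<xi> a)"
    assume u: "?u \<in> Units A"
    hence "\<xi> (?u \<otimes> inv ?u) = 1" by (simp add: character_one[OF assms(1)])
    moreover have "\<xi> ?u = 0" using assms by (simp add: character_minus character_scalar)
    moreover have "\<xi> (?u \<otimes> inv ?u) = \<xi> ?u * \<xi> (inv ?u)"
      using u assms by (intro character_mult) auto
    ultimately show False by simp
  qed
  thus ?thesis by (simp add: spectrum_of_def scalar_def)
qed

end



section \<open>Ideals of an algebra of continuous functions\<close>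

lemma cring_cfun_algebra: "cring (cfun_algebra X :: ('f::topological_field, 'x \<Rightarrow> 'f) module)"
  by (rule Module.algebra.M_cring[OF cfun_algebra_is_algebra])

lemma in_carrier_cfun_algebra:
  "f \<in> carrier (cfun_algebra X) \<longleftrightarrow> f \<in> extensional (topspace X) \<and> continuous_map X euclidean f"
  by (simp add: cfun_algebra_def)

lemma restrict_in_cfun_algebra:
  "restrict f (topspace X) \<in> carrier (cfun_algebra X) \<longleftrightarrow> continuous_map X euclidean f"
  by (simp add: cfun_algebra_def)

lemma cfun_algebra_uminus:
  fixes f :: "'x \<Rightarrow> 'f::topological_field"
  assumes "f \<in> carrier (cfun_algebra X)"
  shows "\<ominus>\<^bsub>cfun_algebra X\<^esub> f = (\<lambda>x\<in>topspace X. - 1 * f x)"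
proof -
  interpret C: cring "cfun_algebra X :: ('f, 'x \<Rightarrow> 'f) module" by (rule cring_cfun_algebra)
  have "continuous_map X euclidean (\<lambda>x. - 1 * f x)"
    using assms continuous_map_field_mult[of X "\<lambda>_. - 1" f] by (simp add: in_carrier_cfun_algebra)
  moreover have "(\<lambda>x\<in>topspace X. - 1 * f x) \<oplus>\<^bsub>cfun_algebra X\<^esub> f = \<zero>\<^bsub>cfun_algebra X\<^esub>"
    by (rule ext) (simp add: cfun_algebra_def)
  ultimately show ?thesis
    using assms by (intro C.minus_equality) (simp_all only: restrict_in_cfun_algebra)
qed

text \<open>
  The Stone-Weierstrass property with the subalgebra described by pointwise closure conditions.
\<close>

lemma stone_weierstrass_dense:
  fixes f :: "'x \<Rightarrow> 'f::topological_field"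
  assumes SW: "stone_weierstrass TYPE('f)" and X: "compact_space X" "Hausdorff_space X"
    and sub: "B \<subseteq> carrier (cfun_algebra X)"
    and const: "\<And>c. (\<lambda>x\<in>topspace X. c) \<in> B"
    and add: "\<And>f g. f \<in> B \<Longrightarrow> g \<in> B \<Longrightarrow> (\<lambda>x\<in>topspace X. f x + g x) \<in> B"
    and mult: "\<And>f g. f \<in> B \<Longrightarrow> g \<in> B \<Longrightarrow> (\<lambda>x\<in>topspace X. f x * g x) \<in> B"
    and conj: "\<And>f. f \<in> B \<Longrightarrow> (\<lambda>x\<in>topspace X. scalar_conj (f x)) \<in> B"
    and sep: "\<And>x y. x \<in> topspace X \<Longrightarrow> y \<in> topspace X \<Longrightarrow> x \<noteq> y \<Longrightarrow> \<exists>f\<in>B. f x \<noteq> f y"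
    and f: "continuous_map X euclidean f" and U: "open U" "0 \<in> U"
  obtains g where "g \<in> B" "\<And>x. x \<in> topspace X \<Longrightarrow> g x - f x \<in> U"
proof -
  let ?C = "cfun_algebra X :: ('f, 'x \<Rightarrow> 'f) module"
  interpret C: cring ?C by (rule cring_cfun_algebra)
  have scale: "(\<lambda>x\<in>topspace X. c * g x) \<in> B" if "g \<in> B" for c g
  proof -
    have "(\<lambda>x\<in>topspace X. (\<lambda>x\<in>topspace X. c) x * g x) \<in> B" by (rule mult[OF const that])
    thus ?thesis by (simp cong: restrict_cong)
  qed
  have minus: "\<ominus>\<^bsub>?C\<^esub> g \<in> B" if "g \<in> B" for g
    using scale[OF that, of "- 1"] cfun_algebra_uminus[of g X] sub that by auto
  have ring: "subring B ?C"
  proof (rule C.subringI[OF sub])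
    show "\<one>\<^bsub>?C\<^esub> \<in> B" using const[of 1] by (simp add: cfun_algebra_def)
    show "g \<otimes>\<^bsub>?C\<^esub> g' \<in> B" "g \<oplus>\<^bsub>?C\<^esub> g' \<in> B" if "g \<in> B" "g' \<in> B" for g g'
      using add[OF that] mult[OF that] by (simp_all add: cfun_algebra_def)
  qed (rule minus)
  have module: "submodule B field_ring ?C"
  proof (rule module.submoduleI[OF Module.algebra.module[OF cfun_algebra_is_algebra] sub])
    show "\<zero>\<^bsub>?C\<^esub> \<in> B" using const[of 0] by (simp add: cfun_algebra_def)
    show "g \<oplus>\<^bsub>?C\<^esub> g' \<in> B" if "g \<in> B" "g' \<in> B" for g g'
      using add[OF that] by (simp add: cfun_algebra_def)
    show "c \<odot>\<^bsub>?C\<^esub> g \<in> B" if "g \<in> B" for c g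
      using scale[OF that] by (simp add: cfun_algebra_def)
  qed (rule minus)
  have "\<exists>g\<in>B. \<forall>x\<in>topspace X. g x - restrict f (topspace X) x \<in> U"
    using stone_weierstrass_every_type[OF SW X, unfolded stone_weierstrass_on_def,
        rule_format, of B "restrict f (topspace X)" U]
      ring module const sep conj U f
    by (simp add: restrict_in_cfun_algebra conj_along_eq_scalar_conj)
  thus ?thesis using that by auto
qed

text \<open>
  For \<open>F = \<real>\<close> one takes a sum of squares of finitely many functions in \<open>I\<close> without common
  zero; over an algebraically closed field no polynomial can replace the sum of squares.
  Stone-Weierstrass can: if \<open>I\<close> has no common zero, fix a point \<open>x0\<close> and consider the functions
  that differ from a constant by an element of \<open>I\<close> vanishing at \<open>x0\<close>.  They form a subalgebra
  \<open>B\<close>, and they separate points because products \<open>g i\<close> with \<open>i \<in> I\<close> can be localised by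
  the choice of \<open>g\<close>.  Hence \<open>B\<close> is dense.  Take \<open>f \<in> I\<close> with \<open>f(x0) = 1\<close> and approximate
  \<open>1 - f\<close> by \<open>b \<in> B\<close>.  Since \<open>1 - f\<close> vanishes at \<open>x0\<close>, the constant \<open>b(x0)\<close> is small, so
  the element \<open>f + (b - b(x0))\<close> of \<open>I\<close> is close to \<open>1\<close> and thus a unit.
\<close>

theorem proper_ideal_has_common_zero:
  fixes X :: "'x topology"
  assumes SW: "stone_weierstrass TYPE('f::topological_field)"
    and X: "compact_space X" "F_Tychonoff TYPE('f) X"
    and I: "ideal I (cfun_algebra X :: ('f, 'x \<Rightarrow> 'f) module)" "I \<noteq> carrier (cfun_algebra X)"
  shows "\<exists>x\<in>topspace X. \<forall>f\<in>I. f x = 0"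
proof (rule ccontr)
  let ?C = "cfun_algebra X :: ('f, 'x \<Rightarrow> 'f) module" and ?T = "topspace X"
  interpret C: cring ?C by (rule cring_cfun_algebra)
  interpret I: ideal I ?C by (rule I(1))
  assume "\<not> (\<exists>x\<in>?T. \<forall>f\<in>I. f x = 0)"
  hence nz: "\<exists>f\<in>I. f x \<noteq> 0" if "x \<in> ?T" for x using that by blast
  have I_cont: "continuous_map X euclidean f" if "f \<in> I" for f
    using I.Icarr[OF that] by (simp add: in_carrier_cfun_algebra)
  have I_add: "(\<lambda>x\<in>?T. f x + g x) \<in> I" if "f \<in> I" "g \<in> I" for f g
    using I.a_closed[OF that] by (simp add: cfun_algebra_def)
  have I_mult: "(\<lambda>x\<in>?T. g x * f x) \<in> I" if "f \<in> I" "continuous_map X euclidean g" for f g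
  proof -
    have "restrict g ?T \<otimes>\<^bsub>?C\<^esub> f \<in> I"
      using that by (intro I.I_l_closed) (simp_all add: restrict_in_cfun_algebra)
    thus ?thesis by (simp add: cfun_algebra_def cong: restrict_cong)
  qed
  have I_zero: "(\<lambda>x\<in>?T. 0) \<in> I" using I.zero_closed by (simp add: cfun_algebra_def)
  have one_notin: "(\<lambda>x\<in>?T. 1) \<notin> I"
    using I.one_imp_carrier I(2) by (auto simp: cfun_algebra_def)
  have "?T \<noteq> {}" using I_zero one_notin by (auto simp: restrict_def)
  then obtain x0 where x0: "x0 \<in> ?T" by blast

  \<comment> \<open>The second condition makes \<open>B\<close> closed under conjugation when the field is \<open>\<complex>\<close>.\<close>
  define B where "B = {f \<in> carrier ?C. (\<lambda>x\<in>?T. f x - f x0) \<in> I \<and>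
      (\<lambda>x\<in>?T. scalar_conj (f x) - scalar_conj (f x0)) \<in> I}"
  have B_cont: "continuous_map X euclidean f" if "f \<in> B" for f
    using that by (simp add: B_def in_carrier_cfun_algebra)
  have Bsub: "B \<subseteq> carrier ?C" by (auto simp: B_def)
  have BI: "restrict f ?T \<in> B" if "continuous_map X euclidean f" "(\<lambda>x\<in>?T. f x - f x0) \<in> I"
    "(\<lambda>x\<in>?T. scalar_conj (f x) - scalar_conj (f x0)) \<in> I" for f
    using that x0 by (simp add: B_def restrict_in_cfun_algebra cong: restrict_cong)
  have BD: "(\<lambda>x\<in>?T. f x - f x0) \<in> I" "(\<lambda>x\<in>?T. scalar_conj (f x) - scalar_conj (f x0)) \<in> I"
    if "f \<in> B" for f
    using that by (simp_all add: B_def)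

  have const: "(\<lambda>x\<in>?T. c) \<in> B" for c
    by (rule BI) (simp_all add: I_zero)
  have add: "(\<lambda>x\<in>?T. f x + g x) \<in> B" if fg: "f \<in> B" "g \<in> B" for f g
  proof (rule BI)
    show "continuous_map X euclidean (\<lambda>x. f x + g x)"
      using fg by (intro continuous_map_field_add B_cont)
    show "(\<lambda>x\<in>?T. f x + g x - (f x0 + g x0)) \<in> I"
      using I_add[OF BD(1)[OF fg(1)] BD(1)[OF fg(2)]]
      by (simp add: algebra_simps cong: restrict_cong)
    show "(\<lambda>x\<in>?T. scalar_conj (f x + g x) - scalar_conj (f x0 + g x0)) \<in> I"
      using I_add[OF BD(2)[OF fg(1)] BD(2)[OF fg(2)]]
      by (simp add: algebra_simps scalar_conj_add cong: restrict_cong)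
  qed
  \<comment> \<open>Uses \<open>f g - f(x0) g(x0) = g (f - f(x0)) + f(x0) (g - g(x0))\<close>.\<close>
  have prod: "(\<lambda>x\<in>?T. f x * g x - f x0 * g x0) \<in> I"
    if "(\<lambda>x\<in>?T. f x - f x0) \<in> I" "(\<lambda>x\<in>?T. g x - g x0) \<in> I" "continuous_map X euclidean g"
    for f g
    using I_add[OF I_mult[OF that(1,3)] I_mult[OF that(2), of "\<lambda>_. f x0"]]
    by (simp add: algebra_simps cong: restrict_cong)
  have mult: "(\<lambda>x\<in>?T. f x * g x) \<in> B" if fg: "f \<in> B" "g \<in> B" for f g
  proof (rule BI)
    show "continuous_map X euclidean (\<lambda>x. f x * g x)"
      using fg by (intro continuous_map_field_mult B_cont)
    show "(\<lambda>x\<in>?T. f x * g x - f x0 * g x0) \<in> I"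
      using fg by (intro prod BD B_cont)
    show "(\<lambda>x\<in>?T. scalar_conj (f x * g x) - scalar_conj (f x0 * g x0)) \<in> I"
      unfolding scalar_conj_mult
      using fg by (intro prod BD continuous_map_scalar_conj B_cont)
  qed
  have conj: "(\<lambda>x\<in>?T. scalar_conj (f x)) \<in> B" if "f \<in> B" for f
    using that by (intro BI continuous_map_scalar_conj B_cont) (simp_all add: scalar_conj_conj BD)

  have vanish: "\<exists>b\<in>B. b z \<noteq> b w" if zw: "z \<in> ?T" "w \<in> ?T" "z \<noteq> w" "z \<noteq> x0" for z w
  proof -
    obtain i where i: "i \<in> I" "i z \<noteq> 0" using nz[OF zw(1)] by blast
    have "closedin X {w, x0}"
      using X(2) zw(2) x0 by (simp add: F_Tychonoff_def t1_space_closedin_finite)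
    then obtain g :: "'x \<Rightarrow> 'f" where g: "continuous_map X euclidean g" "g z = 1" "g w = 0" "g x0 = 0"
      using X(2) zw unfolding F_Tychonoff_def
      by (metis Diff_iff insertCI insertE singletonD)
    define h where "h = (\<lambda>x. g x * i x)"
    have ch: "continuous_map X euclidean h"
      unfolding h_def by (intro continuous_map_field_mult g I_cont i)
    \<comment> \<open>An ideal need not contain the conjugate of \<open>h\<close>, but \<open>b\<close> is its own conjugate.\<close>
    define b where "b = (\<lambda>x. scalar_conj (h x) * h x)"
    have "restrict h ?T \<in> I" unfolding h_def by (rule I_mult[OF i(1) g(1)])
    hence "(\<lambda>x\<in>?T. scalar_conj (h x) * restrict h ?T x) \<in> I"
      by (intro I_mult continuous_map_scalar_conj ch)
    hence bI: "(\<lambda>x\<in>?T. b x) \<in> I" by (simp add: b_def cong: restrict_cong)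
    have b0: "b x0 = 0" "b w = 0" "b z \<noteq> 0" using g i by (simp_all add: b_def h_def)
    have "scalar_conj (b x) = b x" for x
      by (simp add: b_def scalar_conj_mult scalar_conj_conj mult.commute)
    hence "restrict b ?T \<in> B"
      using bI b0 ch
      by (intro BI) (simp_all add: b_def continuous_map_field_mult continuous_map_scalar_conj)
    thus ?thesis using b0 zw by (intro bexI[of _ "restrict b ?T"]) auto
  qed
  have sep: "\<exists>b\<in>B. b x \<noteq> b y" if "x \<in> ?T" "y \<in> ?T" "x \<noteq> y" for x y
    using vanish[of x y] vanish[of y x] that by metis

  obtain f0 where f0: "f0 \<in> I" "f0 x0 \<noteq> 0" using nz[OF x0] by blast
  define f where "f = (\<lambda>x\<in>?T. inverse (f0 x0) * f0 x)"
  have f: "f \<in> I" unfolding f_def by (rule I_mult[OF f0(1)]) simp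
  have f1: "f x0 = 1" using f0 x0 by (simp add: f_def)
  \<comment> \<open>A sum of two elements of \<open>V\<close> is not \<open>-1\<close>, so \<open>1\<close> plus such a sum is not \<open>0\<close>.\<close>
  have "open (- {- 1 :: 'f})" "0 \<in> - {- 1 :: 'f}" by (auto intro: open_Compl)
  then obtain V :: "'f set" where V: "open V" "0 \<in> V" "uminus ` V = V"
    "\<And>x y. x \<in> V \<Longrightarrow> y \<in> V \<Longrightarrow> x + y \<in> - {- 1}"
    by (rule open_symmetric_half_nhd) blast
  have "continuous_map X euclidean (\<lambda>x. 1 - f x)"
    by (rule continuous_map_field_diff) (simp_all add: I_cont f)
  then obtain b where b: "b \<in> B" "\<And>x. x \<in> ?T \<Longrightarrow> b x - (1 - f x) \<in> V"
    using stone_weierstrass_dense[OF SW X(1) F_Tychonoff_imp_Hausdorff[OF X(2)]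
        Bsub const add mult conj sep _ V(1,2)] by blast
  define i where "i = (\<lambda>x\<in>?T. f x + (\<lambda>x\<in>?T. b x - b x0) x)"
  have i: "i \<in> I" unfolding i_def by (rule I_add[OF f BD(1)[OF b(1)]])
  have "i x \<noteq> 0" if x: "x \<in> ?T" for x
  proof -
    have "- b x0 \<in> V" using symmetric_nhd_minus[OF V(3) b(2)[OF x0]] f1 by simp
    from V(4)[OF b(2)[OF x] this] show ?thesis using x by (auto simp: i_def algebra_simps)
  qed
  hence "(\<lambda>x\<in>?T. inverse (i x) * i x) \<in> I"
    by (intro I_mult[OF i] continuous_map_field_inverse I_cont[OF i]) 
  moreover have "(\<lambda>x\<in>?T. inverse (i x) * i x) = (\<lambda>x\<in>?T. 1)"
    using \<open>\<And>x. x \<in> ?T \<Longrightarrow> i x \<noteq> 0\<close> by (auto simp: fun_eq_iff restrict_def)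
  ultimately show False using one_notin by simp
qed



section \<open>Uniform limits\<close>

lemma tendsto_iff_diff_nhds_0:
  fixes f :: "'x \<Rightarrow> 'f::topological_field"
  shows "(f \<longlongrightarrow> l) F \<longleftrightarrow> (\<forall>U. open U \<longrightarrow> 0 \<in> U \<longrightarrow> (\<forall>\<^sub>F x in F. f x - l \<in> U))"
proof
  assume "(f \<longlongrightarrow> l) F"
  hence "((\<lambda>x. f x - l) \<longlongrightarrow> l - l) F" by (intro tendsto_intros)
  thus "\<forall>U. open U \<longrightarrow> 0 \<in> U \<longrightarrow> (\<forall>\<^sub>F x in F. f x - l \<in> U)"
    by (auto dest: topological_tendstoD)
next
  assume "\<forall>U. open U \<longrightarrow> 0 \<in> U \<longrightarrow> (\<forall>\<^sub>F x in F. f x - l \<in> U)"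
  hence "((\<lambda>x. f x - l) \<longlongrightarrow> 0) F" by (intro topological_tendstoI) auto
  hence "((\<lambda>x. f x - l + l) \<longlongrightarrow> 0 + l) F" by (intro tendsto_intros)
  thus "(f \<longlongrightarrow> l) F" by simp
qed

text \<open>
  The usual three-term estimate for \<open>l y - l x\<close>; the nested neighbourhoods \<open>W + W \<subseteq> V\<close> and
  \<open>V + V \<subseteq> U\<close> accommodate the three terms.
\<close>

lemma continuous_map_uniform_limit_field:
  fixes l :: "'x \<Rightarrow> 'f::topological_field"
  assumes approx: "\<And>U. open U \<Longrightarrow> 0 \<in> U \<Longrightarrow>
    \<exists>g. continuous_map X euclidean g \<and> (\<forall>x\<in>topspace X. l x - g x \<in> U)"
  shows "continuous_map X euclidean l"
  unfolding continuous_map_field_iff tendsto_iff_diff_nhds_0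
proof (intro ballI allI impI)
  fix x and U :: "'f set"
  assume x: "x \<in> topspace X" and U: "open U" "0 \<in> U"
  obtain V where V: "open V" "0 \<in> V" "\<And>x y. x \<in> V \<Longrightarrow> y \<in> V \<Longrightarrow> x + y \<in> U"
    by (rule open_symmetric_half_nhd[OF U]) blast
  obtain W where W: "open W" "0 \<in> W" "uminus ` W = W" "\<And>x y. x \<in> W \<Longrightarrow> y \<in> W \<Longrightarrow> x + y \<in> V"
    by (rule open_symmetric_half_nhd[OF V(1,2)]) blast
  have WV: "w \<in> V" if "w \<in> W" for w using W(4)[OF that W(2)] by simp
  obtain g where g: "continuous_map X euclidean g" "\<And>x. x \<in> topspace X \<Longrightarrow> l x - g x \<in> W"
    using approx[OF W(1,2)] by blast
  have "\<forall>\<^sub>F y in atin X x. g y - g x \<in> W"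
    using g(1) x W(1,2) unfolding continuous_map_field_iff tendsto_iff_diff_nhds_0 by blast
  moreover have "\<forall>\<^sub>F y in atin X x. y \<in> topspace X"
    using x by (auto simp: eventually_atin)
  ultimately show "\<forall>\<^sub>F y in atin X x. l y - l x \<in> U"
  proof eventually_elim
    case (elim y)
    have "g x - l x \<in> W" using symmetric_nhd_minus[OF W(3) g(2)[OF x]] by simp
    hence "(g y - g x) + (g x - l x) \<in> V" by (rule W(4)[OF elim(1)])
    hence "(l y - g y) + ((g y - g x) + (g x - l x)) \<in> U"
      by (rule V(3)[OF WV[OF g(2)[OF elim(2)]]])
    thus ?case by simp
  qed
qed

lemma le_canonical_uniformity_iff:
  "F \<le> canonical_uniformity A \<longleftrightarrow>
     (\<forall>U. open U \<longrightarrow> 0 \<in> U \<longrightarrow> uminus ` U = U \<longrightarrow> (\<forall>\<^sub>F p in F. p \<in> canonical_entourage A U))"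
  by (auto simp: canonical_uniformity_def le_INF_iff le_principal)


section \<open>Algebras of all continuous functions\<close>

text \<open>
  The setting of the necessity of the conditions: \<open>A\<close> is a function algebra through \<open>h\<close>.  The
  points of \<open>X\<close> give characters of \<open>A\<close>, and each condition is read off from them.
\<close>

locale function_representation = field_algebra A
  for A :: "('f::topological_field, 'a, 'm) module_scheme" (structure) +
  fixes X :: "'x topology" and h :: "'a \<Rightarrow> 'x \<Rightarrow> 'f"
  assumes SW: "stone_weierstrass TYPE('f)"
    and compact: "compact_space X" and Tychonoff: "F_Tychonoff TYPE('f) X"
    and iso: "h \<in> algebra_iso A (cfun_algebra X)"
begin

lemma ring_iso: "h \<in> ring_iso A (cfun_algebra X)"
  using iso by (simp add: algebra_iso_def)

lemma
  assumes "a \<in> carrier A"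
  shows h_closed: "h a \<in> carrier (cfun_algebra X)"
    and h_continuous: "continuous_map X euclidean (h a)"
  using ring_iso_memE(1)[OF ring_iso assms] by (simp_all add: in_carrier_cfun_algebra)

lemma h_eqI:
  assumes "a \<in> carrier A" "b \<in> carrier A" "\<And>x. x \<in> topspace X \<Longrightarrow> h a x = h b x"
  shows "a = b"
proof -
  have "h a = h b"
    using assms h_closed by (intro extensionalityI[of _ "topspace X"]) (auto simp: in_carrier_cfun_algebra)
  thus ?thesis using ring_iso_memE(5)[OF ring_iso] assms by (auto simp: bij_betw_def inj_on_def)
qed

lemma h_surj:
  assumes "continuous_map X euclidean f"
  obtains a where "a \<in> carrier A" "\<And>x. x \<in> topspace X \<Longrightarrow> h a x = f x"
proof -
  have "restrict f (topspace X) \<in> h ` carrier A"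
    using ring_iso_memE(5)[OF ring_iso] assms by (simp add: bij_betw_def restrict_in_cfun_algebra)
  thus ?thesis using that by (metis imageE restrict_apply')
qed

definition evaluation :: "'x \<Rightarrow> 'a \<Rightarrow> 'f" where
  "evaluation x a = h a x"

lemma character_evaluation:
  assumes "x \<in> topspace X"
  shows "character (evaluation x)"
proof -
  have "h (scalar c) = c \<odot>\<^bsub>cfun_algebra X\<^esub> h \<one>" for c
    using iso by (simp add: scalar_def algebra_iso_def)
  thus ?thesis
    using assms ring_iso_memE(2-4)[OF ring_iso]
    by (simp add: character_def evaluation_def cfun_algebra_def)
qed

lemma evaluation_zero_iff:
  assumes "a \<in> carrier A"
  shows "a = \<zero> \<longleftrightarrow> (\<forall>x\<in>topspace X. evaluation x a = 0)"
  using h_eqI[OF assms zero_closed] character_zero[OF character_evaluation] by (auto simp: evaluation_def)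

text \<open>
  The Nullstellensatz for \<open>A\<close>.  It yields that the maximal ideals are the point ideals, and,
  applied to principal ideals, that the spectrum of \<open>a\<close> is its set of values.
\<close>

lemma ideal_in_eval_kernel:
  assumes I: "ideal I A" "I \<noteq> carrier A"
  shows "\<exists>x\<in>topspace X. I \<subseteq> char_kernel (evaluation x)"
proof -
  let ?C = "cfun_algebra X :: ('f, 'x \<Rightarrow> 'f) module"
  interpret I: ideal I A by (rule I(1))
  interpret C: cring ?C by (rule cring_cfun_algebra)
  have surj: "h ` carrier A = carrier ?C" and inj: "inj_on h (carrier A)"
    using ring_iso_memE(5)[OF ring_iso] by (auto simp: bij_betw_def)
  have zero: "h \<zero> = \<zero>\<^bsub>?C\<^esub>"
    using ring_hom_zero[OF _ ring_axioms C.ring_axioms] ring_iso by (auto simp: ring_iso_def)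
  have "ideal (h ` I) ?C"
  proof (rule C.ideal_criterion)
    show "h ` I \<subseteq> carrier ?C" using I.a_subset surj by blast
    show "\<zero>\<^bsub>?C\<^esub> \<in> h ` I" using imageI[OF I.zero_closed, of h] zero by simp
    show "f \<oplus>\<^bsub>?C\<^esub> g \<in> h ` I" if fg: "f \<in> h ` I" "g \<in> h ` I" for f g
    proof -
      obtain a b where ab: "a \<in> I" "b \<in> I" "f = h a" "g = h b" using fg by blast
      hence "f \<oplus>\<^bsub>?C\<^esub> g = h (a \<oplus> b)" by (simp add: I.Icarr ring_iso_memE(3)[OF ring_iso])
      thus ?thesis using ab by simp
    qed
    show "g \<otimes>\<^bsub>?C\<^esub> f \<in> h ` I" if fg: "f \<in> h ` I" "g \<in> carrier ?C" for f g
    proof -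
      obtain a b where ab: "a \<in> I" "b \<in> carrier A" "f = h a" "g = h b" using fg surj by blast
      hence "g \<otimes>\<^bsub>?C\<^esub> f = h (b \<otimes> a)" by (simp add: I.Icarr ring_iso_memE(2)[OF ring_iso])
      thus ?thesis using ab I.I_l_closed by simp
    qed
  qed
  moreover have "h ` I \<noteq> carrier ?C"
    using I(2) I.a_subset surj inj by (metis inj_on_image_eq_iff order_refl)
  ultimately obtain x where "x \<in> topspace X" "\<forall>f\<in>h ` I. f x = 0"
    using proper_ideal_has_common_zero[OF SW compact Tychonoff] by blast
  thus ?thesis using I.a_subset by (auto simp: char_kernel_def evaluation_def)
qed

lemma Max_ideals_eq: "Max_ideals A = (\<lambda>x. char_kernel (evaluation x)) ` topspace X"
proof safe
  fix M assume "M \<in> Max_ideals A"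
  then interpret M: maximalideal M A by (simp add: Max_ideals_def)
  obtain x where x: "x \<in> topspace X" "M \<subseteq> char_kernel (evaluation x)"
    using ideal_in_eval_kernel[OF M.is_ideal] M.I_notcarr by blast
  interpret K: maximalideal "char_kernel (evaluation x)" A
    by (rule char_kernel_maximal[OF character_evaluation[OF x(1)]])
  have "char_kernel (evaluation x) = M"
    using M.I_maximal[OF K.is_ideal x(2)] K.I_notcarr K.a_subset by auto
  thus "M \<in> (\<lambda>x. char_kernel (evaluation x)) ` topspace X" using x(1) by blast
qed (simp add: Max_ideals_def char_kernel_maximal character_evaluation)

lemma value_at_eval_kernel:
  "\<lbrakk>x \<in> topspace X; a \<in> carrier A\<rbrakk> \<Longrightarrow> value_at A (char_kernel (evaluation x)) a = evaluation x a"
  by (intro value_at_char_kernel character_evaluation)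

lemma gelfand: "gelfand_algebra A"
  by (rule gelfandI) (auto simp: Max_ideals_eq intro: character_evaluation)

lemma semisimple: "semisimple_algebra A"
  unfolding semisimple_algebra_def Max_ideals_eq
  using evaluation_zero_iff evaluation_zero_iff[OF zero_closed] by (auto simp: char_kernel_def)

lemma spectrum_eq:
  assumes a: "a \<in> carrier A"
  shows "spectrum_of A a = (\<lambda>x. evaluation x a) ` topspace X"
proof safe
  fix c assume "c \<in> spectrum_of A a"
  hence nu: "a \<ominus> scalar c \<notin> Units A" by (simp add: spectrum_of_def scalar_def)
  let ?u = "a \<ominus> scalar c"
  have u: "?u \<in> carrier A" using a by simp
  have "PIdl ?u \<noteq> carrier A"
  proof
    assume "PIdl ?u = carrier A"
    then obtain v where "v \<in> carrier A" "\<one> = v \<otimes> ?u" using one_closed by (auto simp: cgenideal_def)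
    thus False using nu u by (auto simp: Units_def m_comm)
  qed
  then obtain x where "x \<in> topspace X" "PIdl ?u \<subseteq> char_kernel (evaluation x)"
    using ideal_in_eval_kernel[OF cgenideal_ideal[OF u]] by blast
  hence "?u \<in> char_kernel (evaluation x)" using cgenideal_self[OF u] by blast
  hence "c = evaluation x a"
    using diff_scalar_in_char_kernel[OF character_evaluation[OF \<open>x \<in> topspace X\<close>] a] by simp
  thus "c \<in> (\<lambda>x. evaluation x a) ` topspace X" using \<open>x \<in> topspace X\<close> by blast
qed (rule character_in_spectrum[OF character_evaluation a])

lemma compact_spectrum:
  assumes "a \<in> carrier A"
  shows "compact (spectrum_of A a)"
  using image_compactin[OF _ h_continuous[OF assms], of "topspace X"] compact
  by (simp add: spectrum_eq[OF assms] evaluation_def compact_space_def)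

text \<open>
  Two points have disjoint open neighbourhoods, and the Tychonoff property gives functions
  vanishing outside them that are \<open>1\<close> at the respective points.  Their product is \<open>0\<close>, so a prime
  ideal contains one of them and cannot lie in both point ideals.
\<close>

lemma prime_in_unique_maximal:
  assumes P: "primeideal P A"
  shows "\<exists>!M. M \<in> Max_ideals A \<and> P \<subseteq> M"
proof -
  interpret P: primeideal P A by (rule P)
  obtain x where x: "x \<in> topspace X" "P \<subseteq> char_kernel (evaluation x)"
    using ideal_in_eval_kernel[OF P.is_ideal] P.I_notcarr by blast
  have unique: "y = z" if yz: "y \<in> topspace X" "z \<in> topspace X"
    "P \<subseteq> char_kernel (evaluation y)" "P \<subseteq> char_kernel (evaluation z)" for y z
  proof (rule ccontr)
    assume "y \<noteq> z"
    then obtain U V where UV: "openin X U" "openin X V" "y \<in> U" "z \<in> V" "U \<inter> V = {}"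
      using F_Tychonoff_imp_Hausdorff[OF Tychonoff] yz
      unfolding Hausdorff_space_def disjnt_def by metis
    have bump: "\<exists>a\<in>carrier A. evaluation w a = 1 \<and> (\<forall>v\<in>topspace X - W. evaluation v a = 0)"
      if W: "openin X W" "w \<in> W" for w W
    proof -
      have w: "w \<in> topspace X" using W openin_subset by blast
      have "closedin X (topspace X - W)" "w \<in> topspace X - (topspace X - W)"
        using W w by auto
      then obtain f :: "'x \<Rightarrow> 'f" where f: "continuous_map X euclidean f" "f w = 1"
        "\<forall>v\<in>topspace X - W. f v = 0"
        using Tychonoff unfolding F_Tychonoff_def by blast
      obtain a where "a \<in> carrier A" "\<And>v. v \<in> topspace X \<Longrightarrow> h a v = f v"
        using h_surj[OF f(1)] by blast
      thus ?thesis using f w by (intro bexI[of _ a]) (auto simp: evaluation_def)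
    qed
    obtain a where a: "a \<in> carrier A" "evaluation y a = 1" "\<forall>v\<in>topspace X - U. evaluation v a = 0"
      using bump[OF UV(1,3)] by blast
    obtain b where b: "b \<in> carrier A" "evaluation z b = 1" "\<forall>v\<in>topspace X - V. evaluation v b = 0"
      using bump[OF UV(2,4)] by blast
    have "evaluation v a * evaluation v b = 0" if "v \<in> topspace X" for v
      using a(3) b(3) UV(5) that by (cases "v \<in> U") auto
    hence "a \<otimes> b = \<zero>"
      using a(1) b(1) by (subst evaluation_zero_iff) (simp_all add: character_mult[OF character_evaluation])
    hence "a \<in> P \<or> b \<in> P" using P.I_prime[OF a(1) b(1)] P.zero_closed by simp
    thus False using yz a b by (auto simp: char_kernel_def)
  qed
  show ?thesis
  proof (rule ex1I[of _ "char_kernel (evaluation x)"])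
    show "char_kernel (evaluation x) \<in> Max_ideals A \<and> P \<subseteq> char_kernel (evaluation x)"
      using x by (auto simp: Max_ideals_eq)
    fix M assume "M \<in> Max_ideals A \<and> P \<subseteq> M"
    thus "M = char_kernel (evaluation x)" using unique x by (auto simp: Max_ideals_eq)
  qed
qed

lemma canonical_entourage_eval:
  "canonical_entourage A U =
     {(a, b) \<in> carrier A \<times> carrier A. \<forall>x\<in>topspace X. evaluation x b - evaluation x a \<in> U}"
  unfolding canonical_entourage_def Max_ideals_eq
  by (auto simp: value_at_eval_kernel character_minus[OF character_evaluation])

text \<open>
  A Cauchy filter on \<open>A\<close> is Cauchy at each point, uniformly in the point.  The pointwise limits
  exist since \<open>F\<close> is complete, they are attained uniformly, and hence define a continuous function.
\<close>

lemma complete_for_canonical_uniformity: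
  assumes F: "complete (UNIV :: 'f set)"
  shows "complete_for (canonical_uniformity A) (carrier A)"
  unfolding complete_for_def
proof (intro allI impI)
  fix \<Phi> :: "'a filter"
  assume \<Phi>: "\<Phi> \<le> principal (carrier A)" "\<Phi> \<noteq> bot" "\<Phi> \<times>\<^sub>F \<Phi> \<le> canonical_uniformity A"
  have small: "\<exists>Q. eventually Q \<Phi> \<and> (\<forall>a b. Q a \<longrightarrow> Q b \<longrightarrow> (\<forall>x\<in>topspace X. evaluation x b - evaluation x a \<in> U))"
    if U: "open U" "0 \<in> U" for U :: "'f set"
  proof -
    obtain V where V: "open V" "0 \<in> V" "uminus ` V = V" "\<And>x y. x \<in> V \<Longrightarrow> y \<in> V \<Longrightarrow> x + y \<in> U"
      by (rule open_symmetric_half_nhd[OF U]) blast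
    have VU: "v \<in> U" if "v \<in> V" for v using V(4)[OF that V(2)] by simp
    have "\<forall>\<^sub>F p in \<Phi> \<times>\<^sub>F \<Phi>. p \<in> canonical_entourage A V"
      using \<Phi>(3) V unfolding le_canonical_uniformity_iff by blast
    then obtain Q where "eventually Q \<Phi>" "\<And>a b. Q a \<Longrightarrow> Q b \<Longrightarrow> (a, b) \<in> canonical_entourage A V"
      unfolding eventually_prod_same by blast
    thus ?thesis using VU by (intro exI[of _ Q]) (auto simp: canonical_entourage_eval)
  qed
  have "\<exists>l. ((\<lambda>a. evaluation x a) \<longlongrightarrow> l) \<Phi>" if x: "x \<in> topspace X" for x
  proof -
    have "cauchy_filter (filtermap (evaluation x) \<Phi>)"
      unfolding cauchy_filter_def uniformity_topological_field le_filter_def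
    proof (intro allI impI)
      fix P :: "'f \<times> 'f \<Rightarrow> bool"
      assume "eventually P (filtercomap (\<lambda>(x, y). y - x) (nhds 0))"
      then obtain U where U: "open U" "0 \<in> U" "\<And>s t. t - s \<in> U \<Longrightarrow> P (s, t)"
        unfolding eventually_filtercomap eventually_nhds by fast
      obtain Q where Q: "eventually Q \<Phi>" "\<And>a b. Q a \<Longrightarrow> Q b \<Longrightarrow> evaluation x b - evaluation x a \<in> U"
        using small[OF U(1,2)] x by blast
      have "eventually (\<lambda>t. \<exists>a. Q a \<and> t = evaluation x a) (filtermap (evaluation x) \<Phi>)"
        unfolding eventually_filtermap using Q(1) by eventually_elim blast
      thus "eventually P (filtermap (evaluation x) \<Phi> \<times>\<^sub>F filtermap (evaluation x) \<Phi>)"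
        unfolding eventually_prod_same using Q(2) U(3) by blast
    qed
    moreover have "filtermap (evaluation x) \<Phi> \<noteq> bot" using \<Phi>(2) by (simp add: filtermap_bot_iff)
    ultimately show ?thesis
      using cauchy_filter_complete_converges[OF _ F] by (simp add: filterlim_def)
  qed
  then obtain l where l: "\<And>x. x \<in> topspace X \<Longrightarrow> (evaluation x \<longlongrightarrow> l x) \<Phi>"
    by metis
  have unif: "\<exists>Q. eventually Q \<Phi> \<and> (\<forall>a. Q a \<longrightarrow> (\<forall>x\<in>topspace X. l x - evaluation x a \<in> U))"
    if U: "open U" "0 \<in> U" for U :: "'f set"
  proof -
    obtain V where V: "open V" "0 \<in> V" "uminus ` V = V" "\<And>x y. x \<in> V \<Longrightarrow> y \<in> V \<Longrightarrow> x + y \<in> U"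
      by (rule open_symmetric_half_nhd[OF U]) blast
    obtain Q where Q: "eventually Q \<Phi>"
      "\<And>a b x. Q a \<Longrightarrow> Q b \<Longrightarrow> x \<in> topspace X \<Longrightarrow> evaluation x b - evaluation x a \<in> V"
      using small[OF V(1,2)] by blast
    have "l x - evaluation x a \<in> U" if a: "Q a" and x: "x \<in> topspace X" for a x
    proof -
      have "\<forall>\<^sub>F b in \<Phi>. evaluation x b - l x \<in> V"
        using l[OF x] V(1,2) unfolding tendsto_iff_diff_nhds_0 by blast
      hence "\<forall>\<^sub>F b in \<Phi>. Q b \<and> evaluation x b - l x \<in> V" using Q(1) by eventually_elim simp
      then obtain b where b: "Q b" "evaluation x b - l x \<in> V"
        using \<Phi>(2) eventually_happens by blast
      have "- (evaluation x b - l x) + (evaluation x b - evaluation x a) \<in> U"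
        by (rule V(4)[OF symmetric_nhd_minus[OF V(3) b(2)] Q(2)[OF a b(1) x]])
      thus ?thesis by simp
    qed
    thus ?thesis using Q(1) by blast
  qed
  have inA: "\<forall>\<^sub>F a in \<Phi>. a \<in> carrier A" using \<Phi>(1) by (simp add: le_principal)
  have "continuous_map X euclidean l"
  proof (rule continuous_map_uniform_limit_field)
    fix U :: "'f set" assume U: "open U" "0 \<in> U"
    obtain Q where Q: "eventually Q \<Phi>" "\<And>a x. Q a \<Longrightarrow> x \<in> topspace X \<Longrightarrow> l x - evaluation x a \<in> U"
      using unif[OF U] by blast
    have "\<forall>\<^sub>F a in \<Phi>. Q a \<and> a \<in> carrier A" using Q(1) inA by eventually_elim simp
    then obtain a where "Q a" "a \<in> carrier A" using \<Phi>(2) eventually_happens by blast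
    thus "\<exists>g. continuous_map X euclidean g \<and> (\<forall>x\<in>topspace X. l x - g x \<in> U)"
      using Q(2) h_continuous by (intro exI[of _ "h a"]) (auto simp: evaluation_def)
  qed
  then obtain b where b: "b \<in> carrier A" "\<And>x. x \<in> topspace X \<Longrightarrow> evaluation x b = l x"
    using h_surj unfolding evaluation_def by metis
  have "filtermap (Pair b) \<Phi> \<le> canonical_uniformity A"
    unfolding le_canonical_uniformity_iff eventually_filtermap
  proof (intro allI impI)
    fix U :: "'f set" assume U: "open U" "0 \<in> U" "uminus ` U = U"
    obtain Q where Q: "eventually Q \<Phi>" "\<And>a x. Q a \<Longrightarrow> x \<in> topspace X \<Longrightarrow> l x - evaluation x a \<in> U"
      using unif[OF U(1,2)] by blast
    show "\<forall>\<^sub>F a in \<Phi>. (b, a) \<in> canonical_entourage A U"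
      using Q(1) inA
    proof eventually_elim
      case (elim a)
      have "evaluation x a - l x \<in> U" if "x \<in> topspace X" for x
        using symmetric_nhd_minus[OF U(3) Q(2)[OF elim(1) that]] by simp
      thus ?case using elim(2) b by (auto simp: canonical_entourage_eval)
    qed
  qed
  thus "\<exists>b\<in>carrier A. filtermap (Pair b) \<Phi> \<le> canonical_uniformity A" using b(1) by blast
qed

lemma conj_closed: "conj_closed_algebra A"
  unfolding conj_closed_algebra_def
proof (intro allI impI ballI)
  fix \<phi> :: "'f \<Rightarrow> complex" and a
  assume \<phi>: "complex_identification \<phi>" and a: "a \<in> carrier A"
  obtain b where b: "b \<in> carrier A" "\<And>x. x \<in> topspace X \<Longrightarrow> h b x = scalar_conj (h a x)"
    using h_surj[OF continuous_map_scalar_conj[OF h_continuous[OF a]]] by blast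
  have "value_at A M b = conj_along \<phi> (value_at A M a)" if "M \<in> Max_ideals A" for M
    using that a b unfolding Max_ideals_eq
    by (auto simp: value_at_eval_kernel conj_along_eq_scalar_conj[OF \<phi>] evaluation_def)
  thus "\<exists>b\<in>carrier A. \<forall>M\<in>Max_ideals A. value_at A M b = conj_along \<phi> (value_at A M a)"
    using b(1) by blast
qed

end



section \<open>Prime ideals avoiding a multiplicative set\<close>

context cring
begin

text \<open>
  An ideal that is maximal among those disjoint from \<open>S\<close> is prime: if \<open>a\<close> and \<open>b\<close> are outside
  \<open>M\<close>, both \<open>M + R a\<close> and \<open>M + R b\<close> meet \<open>S\<close>, and the product of two such elements of \<open>S\<close>
  lies in \<open>M\<close> as soon as \<open>a b\<close> does.
\<close>

lemma exists_prime_ideal_avoiding: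
  assumes S: "S \<subseteq> carrier R" "\<one> \<in> S" "\<zero> \<notin> S"
    and mult: "\<And>a b. a \<in> S \<Longrightarrow> b \<in> S \<Longrightarrow> a \<otimes> b \<in> S"
  obtains P where "primeideal P R" "P \<inter> S = {}"
proof -
  let ?A = "{I. ideal I R \<and> I \<inter> S = {}}"
  have "\<exists>M\<in>?A. \<forall>X\<in>?A. M \<subseteq> X \<longrightarrow> X = M"
  proof (rule subset_Zorn_nonempty)
    show "?A \<noteq> {}" using zeroideal S by blast
    fix C assume C: "C \<noteq> {}" "subset.chain ?A C"
    have CI: "ideal I R" "I \<inter> S = {}" if "I \<in> C" for I
      using C(2) that by (auto simp: subset.chain_def)
    have ch: "I \<subseteq> J \<or> J \<subseteq> I" if "I \<in> C" "J \<in> C" for I J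
      using C(2) that unfolding subset_chain_def by blast
    have "ideal (\<Union>C) R"
    proof (rule ideal_criterion)
      show "\<Union>C \<subseteq> carrier R" using CI(1) ideal.Icarr by fast
      obtain I where "I \<in> C" using C(1) by blast
      thus "\<zero> \<in> \<Union>C"
        using additive_subgroup.zero_closed[OF ideal.axioms(1)[OF CI(1)]] by blast
      show "x \<otimes> a \<in> \<Union>C" if "a \<in> \<Union>C" "x \<in> carrier R" for a x
        using that CI(1) ideal.I_l_closed by fast
      show "a \<oplus> b \<in> \<Union>C" if ab: "a \<in> \<Union>C" "b \<in> \<Union>C" for a b
      proof -
        obtain I J where IJ: "I \<in> C" "a \<in> I" "J \<in> C" "b \<in> J" using ab by blast
        then obtain K where K: "K \<in> C" "a \<in> K" "b \<in> K" using ch[OF IJ(1,3)] by blast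
        have "a \<oplus> b \<in> K"
          by (rule additive_subgroup.a_closed[OF ideal.axioms(1)[OF CI(1)[OF K(1)]] K(2,3)])
        thus ?thesis using K(1) by blast
      qed
    qed
    thus "\<Union>C \<in> ?A" using CI(2) by blast
  qed
  then obtain M where M_max: "M \<in> ?A" "\<forall>X\<in>?A. M \<subseteq> X \<longrightarrow> X = M" by (rule bexE)
  have M: "ideal M R" "M \<inter> S = {}" using M_max(1) by simp_all
  have max: "J = M" if "ideal J R" "J \<inter> S = {}" "M \<subseteq> J" for J
    using M_max(2) that by simp
  interpret M: ideal M R by (rule M(1))
  have meets: "\<exists>m\<in>M. \<exists>x\<in>carrier R. m \<oplus> x \<otimes> a \<in> S" if a: "a \<in> carrier R" "a \<notin> M" for a
  proof (rule ccontr)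
    assume no: "\<not> ?thesis"
    let ?J = "set_add R M (PIdl a)"
    have inJ: "c \<in> ?J \<longleftrightarrow> (\<exists>m\<in>M. \<exists>x\<in>carrier R. c = m \<oplus> x \<otimes> a)" for c
      by (auto simp: set_add_def' cgenideal_def)
    have "ideal ?J R" by (rule add_ideals[OF M(1) cgenideal_ideal[OF a(1)]])
    moreover have "?J \<inter> S = {}" using no by (auto simp: inJ)
    moreover have "M \<subseteq> ?J"
    proof
      fix m assume m: "m \<in> M"
      have "m = m \<oplus> \<zero> \<otimes> a" using M.Icarr[OF m] a(1) by simp
      thus "m \<in> ?J" unfolding inJ using m by blast
    qed
    ultimately have "?J = M" by (rule max)
    moreover have "a = \<zero> \<oplus> \<one> \<otimes> a" using a(1) by simp
    hence "a \<in> ?J" unfolding inJ using M.zero_closed one_closed by blast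
    ultimately show False using a(2) by simp
  qed
  have "primeideal M R"
  proof (rule primeidealI[OF M(1)])
    show "cring R" by (rule is_cring)
    show "carrier R \<noteq> M" using M(2) S(2) one_closed by blast
    fix a b assume ab: "a \<in> carrier R" "b \<in> carrier R" "a \<otimes> b \<in> M"
    show "a \<in> M \<or> b \<in> M"
    proof (rule ccontr)
      assume "\<not> (a \<in> M \<or> b \<in> M)"
      then obtain m x n y where mn: "m \<in> M" "x \<in> carrier R" "m \<oplus> x \<otimes> a \<in> S"
        "n \<in> M" "y \<in> carrier R" "n \<oplus> y \<otimes> b \<in> S"
        using meets[OF ab(1)] meets[OF ab(2)] by blast
      have c: "m \<in> carrier R" "n \<in> carrier R" using mn M.Icarr by auto
      have "(m \<oplus> x \<otimes> a) \<otimes> (n \<oplus> y \<otimes> b) =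
          (n \<oplus> y \<otimes> b) \<otimes> m \<oplus> ((x \<otimes> a) \<otimes> n \<oplus> (x \<otimes> y) \<otimes> (a \<otimes> b))"
        using c mn(2,5) ab(1,2) by algebra
      also have "\<dots> \<in> M"
        using M.I_l_closed[OF mn(1), of "n \<oplus> y \<otimes> b"] M.I_l_closed[OF mn(4), of "x \<otimes> a"]
          M.I_l_closed[OF ab(3), of "x \<otimes> y"] c mn(2,5) ab(1,2)
        by (intro M.a_closed) simp_all
      finally show False using mult[OF mn(3,6)] M(2) by blast
    qed
  qed
  thus ?thesis using M(2) by (rule that)
qed

text \<open>
  This is how the condition on prime ideals is used.  The products \<open>a b\<close> with \<open>a\<close> outside
  \<open>M\<close> and \<open>b\<close> outside \<open>N\<close> form a multiplicative set.  If it did not contain \<open>0\<close>, a prime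
  ideal disjoint from it would lie in both \<open>M\<close> and \<open>N\<close>.
\<close>

lemma separating_annihilators:
  assumes prime: "\<And>P. primeideal P R \<Longrightarrow> \<exists>!M. maximalideal M R \<and> P \<subseteq> M"
    and MN: "maximalideal M R" "maximalideal N R" "M \<noteq> N"
  obtains a b where "a \<in> carrier R" "a \<notin> M" "b \<in> carrier R" "b \<notin> N" "a \<otimes> b = \<zero>"
proof -
  interpret M: primeideal M R by (rule maximalideal_prime[OF MN(1)])
  interpret N: primeideal N R by (rule maximalideal_prime[OF MN(2)])
  have oneM: "\<one> \<notin> M" and oneN: "\<one> \<notin> N"
    using M.one_imp_carrier M.I_notcarr N.one_imp_carrier N.I_notcarr by auto
  define S where "S = {a \<otimes> b | a b. a \<in> carrier R - M \<and> b \<in> carrier R - N}"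
  have SI: "a \<otimes> b \<in> S" if "a \<in> carrier R" "a \<notin> M" "b \<in> carrier R" "b \<notin> N" for a b
    using that by (auto simp: S_def)
  have "\<zero> \<in> S"
  proof (rule ccontr)
    assume zero: "\<zero> \<notin> S"
    have mult: "s \<otimes> t \<in> S" if st: "s \<in> S" "t \<in> S" for s t
    proof -
      obtain a b where ab: "a \<in> carrier R" "a \<notin> M" "b \<in> carrier R" "b \<notin> N" "s = a \<otimes> b"
        using st(1) unfolding S_def by blast
      obtain c d where cd: "c \<in> carrier R" "c \<notin> M" "d \<in> carrier R" "d \<notin> N" "t = c \<otimes> d"
        using st(2) unfolding S_def by blast
      have "s \<otimes> t = (a \<otimes> c) \<otimes> (b \<otimes> d)"
        unfolding ab(5) cd(5) using ab(1,3) cd(1,3) by algebra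
      moreover have "a \<otimes> c \<notin> M" "b \<otimes> d \<notin> N" using M.I_prime N.I_prime ab cd by blast+
      ultimately show ?thesis using SI ab cd by simp
    qed
    have "\<one> \<in> S" using SI[OF one_closed oneM one_closed oneN] by simp
    moreover have "S \<subseteq> carrier R" by (auto simp: S_def)
    ultimately obtain P where P: "primeideal P R" "P \<inter> S = {}"
      using exists_prime_ideal_avoiding[of S] zero mult by blast
    interpret P: primeideal P R by (rule P(1))
    have "P \<subseteq> M"
    proof
      fix p assume p: "p \<in> P"
      show "p \<in> M"
        using SI[OF P.Icarr[OF p] _ one_closed oneN] P.Icarr[OF p] P(2) p by auto
    qed
    moreover have "P \<subseteq> N"
    proof
      fix p assume p: "p \<in> P"
      show "p \<in> N"
        using SI[OF one_closed oneM P.Icarr[OF p]] P.Icarr[OF p] P(2) p by auto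
    qed
    ultimately show False using prime[OF P(1)] MN by blast
  qed
  then obtain a b where "a \<in> carrier R" "a \<notin> M" "b \<in> carrier R" "b \<notin> N" "a \<otimes> b = \<zero>"
    unfolding S_def by (auto simp: eq_commute[of \<zero>])
  thus ?thesis by (rule that)
qed

end


section \<open>The space of characters\<close>

context field_algebra
begin

definition char_space :: "('a \<Rightarrow> 'f) topology" where
  "char_space = subtopology (product_topology (\<lambda>_. euclidean) (carrier A)) characters"

lemma topspace_char_space [simp]: "topspace char_space = characters"
  by (auto simp: char_space_def characters_def PiE_def)

lemma continuous_map_char_space:
  assumes "a \<in> carrier A"
  shows "continuous_map char_space euclidean (\<lambda>\<xi>. \<xi> a)"
  unfolding char_space_def
  by (intro continuous_map_from_subtopology continuous_map_product_projection assms)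

lemma Hausdorff_char_space: "Hausdorff_space char_space"
  unfolding char_space_def
  by (intro Hausdorff_space_subtopology)
    (simp add: Hausdorff_space_product_topology Hausdorff_space_euclidean_t2)

text \<open>
  The defining equations of a character each involve finitely many coordinates and continuous
  operations.
\<close>

lemma closedin_characters:
  "closedin (product_topology (\<lambda>_. euclidean) (carrier A)) characters"
proof -
  define P :: "('a \<Rightarrow> 'f) topology" where "P = product_topology (\<lambda>_. euclidean) (carrier A)"
  have proj: "continuous_map P euclidean (\<lambda>\<xi>. \<xi> a)" if "a \<in> carrier A" for a
    unfolding P_def by (rule continuous_map_product_projection[OF that])
  have eq: "closedin P {\<xi> \<in> topspace P. f \<xi> = g \<xi>}"
    if "continuous_map P euclidean f" "continuous_map P euclidean g" for f g :: "_ \<Rightarrow> 'f"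
    by (rule closedin_continuous_maps_eq[OF Hausdorff_space_euclidean_t2 that])
  have "closedin P (topspace P \<inter>
      (\<Inter>a\<in>carrier A. \<Inter>b\<in>carrier A. {\<xi> \<in> topspace P. \<xi> (a \<oplus> b) = \<xi> a + \<xi> b}) \<inter>
      (\<Inter>a\<in>carrier A. \<Inter>b\<in>carrier A. {\<xi> \<in> topspace P. \<xi> (a \<otimes> b) = \<xi> a * \<xi> b}) \<inter>
      (\<Inter>c. {\<xi> \<in> topspace P. \<xi> (scalar c) = c}))"
    using zero_closed
    by (intro closedin_Int closedin_topspace closedin_INT eq continuous_map_field_add
        continuous_map_field_mult proj) auto
  moreover have "topspace P \<inter>
      (\<Inter>a\<in>carrier A. \<Inter>b\<in>carrier A. {\<xi> \<in> topspace P. \<xi> (a \<oplus> b) = \<xi> a + \<xi> b}) \<inter>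
      (\<Inter>a\<in>carrier A. \<Inter>b\<in>carrier A. {\<xi> \<in> topspace P. \<xi> (a \<otimes> b) = \<xi> a * \<xi> b}) \<inter>
      (\<Inter>c. {\<xi> \<in> topspace P. \<xi> (scalar c) = c}) = characters"
    using zero_closed by (auto simp: P_def characters_def character_def PiE_def extensional_def)
  ultimately show ?thesis by (simp add: P_def)
qed

text \<open>
  The characters form a closed subset of the product of the spectra, which is compact by Tychonoff's
  theorem.
\<close>

lemma compact_char_space:
  assumes "\<And>a. a \<in> carrier A \<Longrightarrow> compact (spectrum_of A a)"
  shows "compact_space char_space"
proof -
  let ?P = "product_topology (\<lambda>_. euclidean :: 'f topology) (carrier A)"
  have "compactin ?P (PiE (carrier A) (spectrum_of A))"
    using assms by (simp add: compactin_PiE)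
  moreover have "characters \<subseteq> PiE (carrier A) (spectrum_of A)"
    by (intro subsetI) (simp add: PiE_iff in_charactersD character_in_spectrum)
  ultimately have "compactin ?P characters"
    by (rule closed_compactin[OF _ _ closedin_characters])
  thus ?thesis by (simp add: char_space_def compact_space_subtopology)
qed

text \<open>
  For each \<open>\<eta> \<in> C\<close> there are \<open>p, q\<close> with \<open>p q = 0\<close>, \<open>\<xi>(p) \<noteq> 0\<close> and
  \<open>\<eta>(q) \<noteq> 0\<close>, so \<open>p\<close> vanishes on a neighbourhood of \<open>\<eta>\<close> but not at \<open>\<xi>\<close>.  The product
  of finitely many such \<open>p\<close>, one for each neighbourhood in a finite subcover of \<open>C\<close>, vanishes on all
  of \<open>C\<close>.
\<close>

lemma F_Tychonoff_char_space:
  assumes compact: "compact_space char_space"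
    and prime: "\<And>P. primeideal P A \<Longrightarrow> \<exists>!M. maximalideal M A \<and> P \<subseteq> M"
  shows "F_Tychonoff TYPE('f) char_space"
  unfolding F_Tychonoff_def
proof (intro conjI allI impI)
  show "t1_space char_space" by (rule Hausdorff_imp_t1_space[OF Hausdorff_char_space])
next
  fix C \<xi> assume "closedin char_space C \<and> \<xi> \<in> topspace char_space - C"
  hence C: "closedin char_space C" "C \<subseteq> characters" and \<xi>: "\<xi> \<in> characters" "\<xi> \<notin> C"
    using closedin_subset by fastforce+
  have "\<exists>a b. a \<in> carrier A \<and> b \<in> carrier A \<and> \<xi> a \<noteq> 0 \<and> \<eta> b \<noteq> 0 \<and> a \<otimes> b = \<zero>" if \<eta>: "\<eta> \<in> C" for \<eta>
  proof -
    have \<eta>': "\<eta> \<in> characters" using \<eta> C by auto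
    have "char_kernel \<xi> \<noteq> char_kernel \<eta>"
      using characters_eqI[OF \<xi>(1) \<eta>'] character_eqI[of \<xi> \<eta>] in_charactersD(1) \<xi> \<eta> \<eta>' by blast
    then obtain a b where "a \<in> carrier A" "a \<notin> char_kernel \<xi>" "b \<in> carrier A" "b \<notin> char_kernel \<eta>"
      "a \<otimes> b = \<zero>"
      using separating_annihilators[OF prime, of "char_kernel \<xi>" "char_kernel \<eta>"]
        char_kernel_maximal in_charactersD(1) \<xi>(1) \<eta>' by metis
    thus ?thesis by (auto simp: char_kernel_def)
  qed
  then obtain p q where pq: "\<And>\<eta>. \<eta> \<in> C \<Longrightarrow> p \<eta> \<in> carrier A \<and> q \<eta> \<in> carrier A \<and>
      \<xi> (p \<eta>) \<noteq> 0 \<and> \<eta> (q \<eta>) \<noteq> 0 \<and> p \<eta> \<otimes> q \<eta> = \<zero>"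
    by metis
  define W where "W = (\<lambda>\<eta>. {\<zeta> \<in> characters. \<zeta> (q \<eta>) \<in> - {0}})"
  have "openin char_space (W \<eta>)" if "\<eta> \<in> C" for \<eta>
    using openin_continuous_map_preimage[OF continuous_map_char_space, of "q \<eta>" "- {0}"] pq[OF that]
    by (simp add: W_def open_Compl)
  moreover have "C \<subseteq> \<Union>(W ` C)" using pq C(2) by (auto simp: W_def)
  moreover have "compactin char_space C" by (rule closedin_compact_space[OF compact C(1)])
  ultimately obtain \<W> where \<W>: "finite \<W>" "\<W> \<subseteq> W ` C" "C \<subseteq> \<Union>\<W>"
    using compactinD[of char_space C "W ` C"] by blast
  obtain D where D: "D \<subseteq> C" "finite D" "\<W> = W ` D" using finite_subset_image[OF \<W>(1,2)] by blast
  have "\<exists>a\<in>carrier A. \<xi> a \<noteq> 0 \<and> (\<forall>\<eta>\<in>D. \<forall>\<zeta>\<in>W \<eta>. \<zeta> a = 0)"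
    using D(2,1)
  proof (induction D rule: finite_induct)
    case empty
    show ?case using character_one[OF in_charactersD(1)[OF \<xi>(1)]] by (intro bexI[of _ \<one>]) simp_all
  next
    case (insert \<eta> D)
    then obtain a where a: "a \<in> carrier A" "\<xi> a \<noteq> 0" "\<And>\<theta> \<zeta>. \<theta> \<in> D \<Longrightarrow> \<zeta> \<in> W \<theta> \<Longrightarrow> \<zeta> a = 0"
      by blast
    have pq': "p \<eta> \<in> carrier A" "q \<eta> \<in> carrier A" "\<xi> (p \<eta>) \<noteq> 0" "p \<eta> \<otimes> q \<eta> = \<zero>"
      using pq[of \<eta>] insert.prems by auto
    have "\<zeta> (p \<eta>) = 0" if "\<zeta> \<in> W \<eta>" for \<zeta>
    proof -
      have \<zeta>: "character \<zeta>" "\<zeta> (q \<eta>) \<noteq> 0" using that by (auto simp: W_def in_charactersD)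
      have "\<zeta> (p \<eta>) * \<zeta> (q \<eta>) = 0"
        using character_mult[OF \<zeta>(1) pq'(1,2)] pq'(4) character_zero[OF \<zeta>(1)] by simp
      thus ?thesis using \<zeta>(2) by simp
    qed
    hence vanish: "\<zeta> (p \<eta>) * \<zeta> a = 0" if "\<theta> \<in> insert \<eta> D" "\<zeta> \<in> W \<theta>" for \<theta> \<zeta>
      using a(3) that by auto
    have prod: "\<zeta> (p \<eta> \<otimes> a) = \<zeta> (p \<eta>) * \<zeta> a" if "\<zeta> \<in> characters" for \<zeta>
      by (rule character_mult[OF in_charactersD(1)[OF that] pq'(1) a(1)])
    show ?case
    proof (intro bexI conjI ballI)
      show "\<xi> (p \<eta> \<otimes> a) \<noteq> 0" using prod[OF \<xi>(1)] a(2) pq'(3) by simp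
      show "\<zeta> (p \<eta> \<otimes> a) = 0" if "\<theta> \<in> insert \<eta> D" "\<zeta> \<in> W \<theta>" for \<theta> \<zeta>
        using prod[of \<zeta>] vanish[OF that] that(2) by (simp add: W_def)
    qed (use pq' a in simp)
  qed
  then obtain a where a: "a \<in> carrier A" "\<xi> a \<noteq> 0" "\<And>\<eta> \<zeta>. \<eta> \<in> D \<Longrightarrow> \<zeta> \<in> W \<eta> \<Longrightarrow> \<zeta> a = 0"
    by blast
  have "\<zeta> a = 0" if "\<zeta> \<in> C" for \<zeta> using that \<W>(3) D(3) a(3) by blast
  moreover have "continuous_map char_space euclidean (\<lambda>\<zeta>. inverse (\<xi> a) * \<zeta> a)"
    by (intro continuous_map_field_mult continuous_map_char_space a) simp
  ultimately show "\<exists>f :: ('a \<Rightarrow> 'f) \<Rightarrow> 'f. continuous_map char_space euclidean f \<and> f \<xi> = 1 \<and> (\<forall>\<eta>\<in>C. f \<eta> = 0)"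
    using a(2) by (intro exI[of _ "\<lambda>\<zeta>. inverse (\<xi> a) * \<zeta> a"]) simp
qed


section \<open>The Gelfand transform\<close>

lemma gelfand_transform_dense:
  assumes SW: "stone_weierstrass TYPE('f)" and compact: "compact_space char_space"
    and gelfand: "gelfand_algebra A" and conj: "conj_closed_algebra A"
    and f: "continuous_map char_space euclidean f" and U: "open U" "0 \<in> U"
  obtains a where "a \<in> carrier A" "\<And>\<xi>. \<xi> \<in> characters \<Longrightarrow> \<xi> a - f \<xi> \<in> U"
proof -
  define B where "B = (\<lambda>a. \<lambda>\<xi>\<in>characters. \<xi> a) ` carrier A"
  have BI: "(\<lambda>\<xi>\<in>characters. g \<xi>) \<in> B" if "a \<in> carrier A" "\<And>\<xi>. \<xi> \<in> characters \<Longrightarrow> \<xi> a = g \<xi>" for a g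
    unfolding B_def using that by (intro image_eqI[of _ _ a]) (auto simp: fun_eq_iff)
  have char: "character \<xi>" if "\<xi> \<in> characters" for \<xi> by (rule in_charactersD(1)[OF that])
  have conj_in_B: "(\<lambda>\<xi>\<in>characters. scalar_conj (g \<xi>)) \<in> B" if g: "g \<in> B" for g
  proof -
    obtain a where a: "a \<in> carrier A" "g = (\<lambda>\<xi>\<in>characters. \<xi> a)" using g by (auto simp: B_def)
    have "\<exists>b\<in>carrier A. \<forall>\<xi>\<in>characters. \<xi> b = scalar_conj (\<xi> a)"
    proof (cases "\<exists>\<phi> :: 'f \<Rightarrow> complex. complex_identification \<phi>")
      case True
      then obtain \<phi> :: "'f \<Rightarrow> complex" where \<phi>: "complex_identification \<phi>" by blast
      obtain b where b: "b \<in> carrier A"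
        "\<And>M. M \<in> Max_ideals A \<Longrightarrow> value_at A M b = conj_along \<phi> (value_at A M a)"
        using conj[unfolded conj_closed_algebra_def, rule_format, OF \<phi> a(1)] by blast
      have "\<xi> b = scalar_conj (\<xi> a)" if "\<xi> \<in> characters" for \<xi>
        using b(2)[OF char_kernel_in_Max_ideals[OF that]] a(1) b(1) char[OF that]
        by (simp add: value_at_char_kernel conj_along_eq_scalar_conj[OF \<phi>])
      thus ?thesis using b(1) by blast
    next
      case False
      thus ?thesis using a(1) by (auto simp: scalar_conj_def)
    qed
    then obtain b where b: "b \<in> carrier A" "\<And>\<xi>. \<xi> \<in> characters \<Longrightarrow> \<xi> b = scalar_conj (\<xi> a)"
      by blast
    show ?thesis using b a(2) by (intro BI[of b]) auto
  qed
  have B: "B \<subseteq> carrier (cfun_algebra char_space)"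
    using continuous_map_char_space by (auto simp: B_def in_carrier_cfun_algebra)
  have const: "(\<lambda>\<xi>\<in>characters. c) \<in> B" for c
    by (rule BI[of "scalar c"]) (simp_all add: char character_scalar)
  have add: "(\<lambda>\<xi>\<in>characters. g \<xi> + g' \<xi>) \<in> B" if gg: "g \<in> B" "g' \<in> B" for g g'
  proof -
    obtain a b where "a \<in> carrier A" "b \<in> carrier A" "g = (\<lambda>\<xi>\<in>characters. \<xi> a)" "g' = (\<lambda>\<xi>\<in>characters. \<xi> b)"
      using gg by (auto simp: B_def)
    thus ?thesis by (intro BI[of "a \<oplus> b"]) (auto simp: character_add char)
  qed
  have mult: "(\<lambda>\<xi>\<in>characters. g \<xi> * g' \<xi>) \<in> B" if gg: "g \<in> B" "g' \<in> B" for g g'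
  proof -
    obtain a b where "a \<in> carrier A" "b \<in> carrier A" "g = (\<lambda>\<xi>\<in>characters. \<xi> a)" "g' = (\<lambda>\<xi>\<in>characters. \<xi> b)"
      using gg by (auto simp: B_def)
    thus ?thesis by (intro BI[of "a \<otimes> b"]) (auto simp: character_mult char)
  qed
  have sep: "\<exists>g\<in>B. g \<xi> \<noteq> g \<eta>" if \<xi>\<eta>: "\<xi> \<in> characters" "\<eta> \<in> characters" "\<xi> \<noteq> \<eta>" for \<xi> \<eta>
  proof -
    obtain a where "a \<in> carrier A" "\<xi> a \<noteq> \<eta> a" using characters_eqI[OF \<xi>\<eta>(1,2)] \<xi>\<eta>(3) by blast
    thus ?thesis using \<xi>\<eta> by (auto simp: B_def)
  qed
  obtain g where g: "g \<in> B" "\<And>\<xi>. \<xi> \<in> characters \<Longrightarrow> g \<xi> - f \<xi> \<in> U"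
    using stone_weierstrass_dense[OF SW compact Hausdorff_char_space B, unfolded topspace_char_space,
        OF const add mult conj_in_B sep f U] by blast
  then obtain a where "a \<in> carrier A" "g = (\<lambda>\<xi>\<in>characters. \<xi> a)" by (auto simp: B_def)
  thus ?thesis using that g(2) by simp
qed

text \<open>
  The elements of \<open>A\<close> whose transforms approximate \<open>f\<close> generate a Cauchy filter on \<open>A\<close>, and an
  element to which it converges has transform \<open>f\<close>.
\<close>

lemma gelfand_transform_surj:
  assumes gelfand: "gelfand_algebra A"
    and complete: "complete_for (canonical_uniformity A) (carrier A)"
    and dense: "\<And>U. open U \<Longrightarrow> 0 \<in> U \<Longrightarrow> \<exists>a\<in>carrier A. \<forall>\<xi>\<in>characters. \<xi> a - f \<xi> \<in> U"
  obtains a where "a \<in> carrier A" "\<And>\<xi>. \<xi> \<in> characters \<Longrightarrow> \<xi> a = f \<xi>"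
proof -
  define N where "N = (\<lambda>U. {a \<in> carrier A. \<forall>\<xi>\<in>characters. \<xi> a - f \<xi> \<in> U})"
  define \<Phi> where "\<Phi> = (INF U\<in>{U :: 'f set. open U \<and> 0 \<in> U}. principal (N U))"
  have ev: "eventually P \<Phi> \<longleftrightarrow> (\<exists>U. open U \<and> 0 \<in> U \<and> (\<forall>a\<in>N U. P a))" for P
    unfolding \<Phi>_def
  proof (subst eventually_INF_base)
    show "\<exists>W\<in>{U. open U \<and> 0 \<in> U}. principal (N W) \<le> inf (principal (N U)) (principal (N V))"
      if "U \<in> {U. open U \<and> 0 \<in> U}" "V \<in> {U. open U \<and> 0 \<in> U}" for U V
      using that by (intro bexI[of _ "U \<inter> V"]) (auto simp: N_def)
  qed (auto simp: eventually_principal intro: exI[of _ UNIV])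
  have nonempty: "N U \<noteq> {}" if "open U" "0 \<in> U" for U
    using dense[OF that] by (auto simp: N_def)
  have "\<Phi> \<noteq> bot"
    using nonempty unfolding trivial_limit_def ev by blast
  moreover have "\<Phi> \<le> principal (carrier A)"
    unfolding le_principal ev by (intro exI[of _ UNIV]) (simp add: N_def)
  moreover have "\<Phi> \<times>\<^sub>F \<Phi> \<le> canonical_uniformity A"
    unfolding le_canonical_uniformity_iff
  proof (intro allI impI)
    fix U :: "'f set" assume U: "open U" "0 \<in> U"
    obtain V where V: "open V" "0 \<in> V" "uminus ` V = V" "\<And>x y. x \<in> V \<Longrightarrow> y \<in> V \<Longrightarrow> x + y \<in> U"
      by (rule open_symmetric_half_nhd[OF U]) blast
    have "(a, b) \<in> canonical_entourage A U" if ab: "a \<in> N V" "b \<in> N V" for a b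
    proof -
      have "\<xi> b - \<xi> a \<in> U" if "\<xi> \<in> characters" for \<xi>
      proof -
        have "\<xi> b - f \<xi> \<in> V" "- (\<xi> a - f \<xi>) \<in> V"
          using ab that by (auto simp: N_def intro!: symmetric_nhd_minus[OF V(3), of "\<xi> a - f \<xi>", simplified])
        from V(4)[OF this] show ?thesis by simp
      qed
      thus ?thesis using ab by (auto simp: canonical_entourage_characters[OF gelfand] N_def)
    qed
    moreover have "eventually (\<lambda>a. a \<in> N V) \<Phi>" unfolding ev using V(1,2) by blast
    ultimately show "\<forall>\<^sub>F p in \<Phi> \<times>\<^sub>F \<Phi>. p \<in> canonical_entourage A U"
      unfolding eventually_prod_same by blast
  qed
  ultimately obtain a where a: "a \<in> carrier A" "filtermap (Pair a) \<Phi> \<le> canonical_uniformity A"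
    using complete unfolding complete_for_def by blast
  have "\<xi> a = f \<xi>" if \<xi>: "\<xi> \<in> characters" for \<xi>
  proof (rule ccontr)
    assume "\<xi> a \<noteq> f \<xi>"
    hence "open (- {\<xi> a - f \<xi>})" "0 \<in> - {\<xi> a - f \<xi>}" by (auto intro: open_Compl)
    then obtain V where V: "open V" "0 \<in> V" "uminus ` V = V"
      "\<And>x y. x \<in> V \<Longrightarrow> y \<in> V \<Longrightarrow> x + y \<in> - {\<xi> a - f \<xi>}"
      by (rule open_symmetric_half_nhd) blast
    have "\<forall>\<^sub>F b in \<Phi>. (a, b) \<in> canonical_entourage A V"
      using a(2) V unfolding le_canonical_uniformity_iff eventually_filtermap by blast
    moreover have "\<forall>\<^sub>F b in \<Phi>. b \<in> N V" unfolding ev using V(1,2) by blast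
    ultimately have "\<forall>\<^sub>F b in \<Phi>. (a, b) \<in> canonical_entourage A V \<and> b \<in> N V"
      by eventually_elim simp
    then obtain b where b: "(a, b) \<in> canonical_entourage A V" "b \<in> N V"
      using \<open>\<Phi> \<noteq> bot\<close> eventually_happens by blast
    have "\<xi> b - \<xi> a \<in> V" "\<xi> b - f \<xi> \<in> V"
      using b \<xi> by (auto simp: canonical_entourage_characters[OF gelfand] N_def)
    from V(4)[OF this(2) symmetric_nhd_minus[OF V(3) this(1)]] show False by simp
  qed
  thus ?thesis using a(1) that by blast
qed

text \<open>
  Semisimplicity makes the transform injective; Stone-Weierstrass with completeness makes it
  surjective.
\<close>

theorem function_algebra_of_conditions:
  assumes SW: "stone_weierstrass TYPE('f)"
    and gelfand: "gelfand_algebra A" and semisimple: "semisimple_algebra A"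
    and spectra: "\<And>a. a \<in> carrier A \<Longrightarrow> compact (spectrum_of A a)"
    and prime: "\<And>P. primeideal P A \<Longrightarrow> \<exists>!M. M \<in> Max_ideals A \<and> P \<subseteq> M"
    and complete: "complete_for (canonical_uniformity A) (carrier A)"
    and conj: "conj_closed_algebra A"
  shows "compact_space char_space" "F_Tychonoff TYPE('f) char_space"
    "(\<lambda>a. \<lambda>\<xi>\<in>characters. \<xi> a) \<in> algebra_iso A (cfun_algebra char_space)"
proof -
  show compact: "compact_space char_space" by (rule compact_char_space[OF spectra])
  show "F_Tychonoff TYPE('f) char_space"
    using prime by (intro F_Tychonoff_char_space[OF compact]) (simp add: Max_ideals_def)
  let ?C = "cfun_algebra char_space :: ('f, ('a \<Rightarrow> 'f) \<Rightarrow> 'f) module"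
  let ?h = "\<lambda>a. \<lambda>\<xi>\<in>characters. \<xi> a"
  have char: "character \<xi>" if "\<xi> \<in> characters" for \<xi> by (rule in_charactersD(1)[OF that])
  have closed: "?h a \<in> carrier ?C" if "a \<in> carrier A" for a
    using continuous_map_char_space[OF that] by (simp add: in_carrier_cfun_algebra)
  have inj: "a = b" if ab: "a \<in> carrier A" "b \<in> carrier A" "?h a = ?h b" for a b
  proof -
    have "\<xi> (a \<ominus> b) = 0" if "\<xi> \<in> characters" for \<xi>
      using fun_cong[OF ab(3), of \<xi>] that ab(1,2) by (simp add: character_minus char)
    hence "\<forall>M\<in>Max_ideals A. restrict (value_at A M) (carrier A) (a \<ominus> b) = 0"
      using all_Max_ideals_iff[OF gelfand, of "\<lambda>\<xi>. \<xi> (a \<ominus> b) = 0"] by simp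
    hence "\<forall>M\<in>Max_ideals A. a \<ominus> b \<in> M"
      using maximal_ideal_of_gelfand(2)[OF gelfand] ab(1,2) by (auto simp: char_kernel_def)
    hence "a \<ominus> b \<in> carrier A \<inter> \<Inter>(Max_ideals A)" using ab(1,2) by blast
    hence "a \<ominus> b = \<zero>" using semisimple unfolding semisimple_algebra_def by blast
    thus ?thesis using ab(1,2) by simp
  qed
  have surj: "\<exists>a\<in>carrier A. f = ?h a" if f: "f \<in> carrier ?C" for f
  proof -
    have "continuous_map char_space euclidean f" using f by (simp add: in_carrier_cfun_algebra)
    hence "\<exists>a\<in>carrier A. \<forall>\<xi>\<in>characters. \<xi> a - f \<xi> \<in> U" if "open U" "0 \<in> U" for U
      using gelfand_transform_dense[OF SW compact gelfand conj _ that] by metis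
    then obtain a where "a \<in> carrier A" "\<And>\<xi>. \<xi> \<in> characters \<Longrightarrow> \<xi> a = f \<xi>"
      using gelfand_transform_surj[OF gelfand complete] by blast
    moreover from this have "f = ?h a"
      using f by (intro extensionalityI[of _ characters]) (auto simp: in_carrier_cfun_algebra)
    ultimately show ?thesis by blast
  qed
  have "bij_betw ?h (carrier A) (carrier ?C)"
    using closed inj surj by (intro bij_betwI') blast+
  hence "?h \<in> ring_iso A ?C"
    using closed
    by (intro ring_iso_memI)
      (auto simp: cfun_algebra_def fun_eq_iff char character_add character_mult character_one)
  moreover have "?h (c \<odot> a) = c \<odot>\<^bsub>?C\<^esub> ?h a" if "a \<in> carrier A" for c a
    using that
    by (auto simp: cfun_algebra_def fun_eq_iff smult_conv_mult character_mult character_scalar char)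
  ultimately show "?h \<in> algebra_iso A ?C" by (simp add: algebra_iso_def)
qed

end

section \<open>The characterisation\<close>

theorem corollary35:
  fixes A :: "('f::topological_field, 'a, 'm) module_scheme"
  assumes "complete (UNIV :: 'f set)"
    and "stone_weierstrass TYPE('f)"
    and "Module.algebra field_ring A"
  shows
    "(\<exists>X :: 'a set topology.
        compact_space X \<and> F_Tychonoff TYPE('f) X \<and> algebra_iso A (cfun_algebra X) \<noteq> {}) \<longleftrightarrow>
     gelfand_algebra A \<and>
     semisimple_algebra A \<and>
     (\<forall>a\<in>carrier A. compact (spectrum_of A a)) \<and>
     (\<forall>P. primeideal P A \<longrightarrow> (\<exists>!M. M \<in> Max_ideals A \<and> P \<subseteq> M)) \<and>
     complete_for (canonical_uniformity A) (carrier A) \<and>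
     conj_closed_algebra A"
    (is "?function_algebra \<longleftrightarrow> ?conditions")
proof
  interpret field_algebra A
    by (intro field_algebra.intro field_algebra_axioms.intro Module.algebra.M_cring[OF assms(3)] assms(3))
  show ?conditions if ?function_algebra
  proof -
    obtain X :: "'a set topology" and h
      where "compact_space X" "F_Tychonoff TYPE('f) X" "h \<in> algebra_iso A (cfun_algebra X)"
      using \<open>?function_algebra\<close> by blast
    then interpret function_representation A X h
      by unfold_locales (use assms(2) in auto)
    show ?conditions
      using gelfand semisimple compact_spectrum prime_in_unique_maximal
        complete_for_canonical_uniformity[OF assms(1)] conj_closed by blast
  qed
  show ?function_algebra if ?conditions
  proof -
    have "gelfand_algebra A" "semisimple_algebra A"
      "\<And>a. a \<in> carrier A \<Longrightarrow> compact (spectrum_of A a)"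
      "\<And>P. primeideal P A \<Longrightarrow> \<exists>!M. M \<in> Max_ideals A \<and> P \<subseteq> M"
      "complete_for (canonical_uniformity A) (carrier A)" "conj_closed_algebra A"
      using \<open>?conditions\<close> by simp_all
    from function_algebra_of_conditions[OF assms(2) this] show ?thesis
      by (rule function_algebra_on_ideals)
  qed
qed

end
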